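(* Let $n\ge2$, $k\ge1$, $w\in\mathcal P_n^k$ with $w\sim\sigma\in P_n^k$. Then $\lambda_w\in\mathrm{Aut}(\mathcal O_n)$ if and only if the following two conditions are satisfied: 1. There exists a partial order $\le$ on $W_n^{k-1}\times W_n^{k-1}$ such that (i) each element of the diagonal $(\alpha,\alpha)$ is minimal; (ii) each $(\alpha,\beta)$ is bounded below by some diagonal element; (iii) for every $i\in\{1,\dots,n\}$ and all $(\alpha,\beta)$ such that $\alpha\ne\beta$, $(f_i^w(\alpha),f_i^w(\beta))\le(\alpha,\beta)$. 2. There exists a partial order $\le$ on $\mathcal W_n^{k-1}$ such that (i) the only minimal element with respect to $\le$ is $\dagger$; (ii) for every $(\alpha,\beta)\in\mathcal W_n^{k-1}$ and all $i,j\in\{1,\dots,n\}$, $f_{ij}^w(\alpha,\beta)\le(\alpha,\beta)$.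
   Context: For $n\ge2$, $\mathcal O_n$ is the Cuntz algebra, generated by isometries $S_1,\dots,S_n$ with $\sum_i S_iS_i^*=1$. $W_n^k$ is the set of $k$-tuples from $\{1,\dots,n\}$ ($W_n^0$ contains only the empty word), and $S_\alpha=S_{\alpha_1}\cdots S_{\alpha_k}$. $P_n^k$ is the group of permutations of the set $W_n^k$; for $\sigma\in P_n^k$ the corresponding unitary is $w=\sum_{\alpha\in W_n^k}S_{\sigma(\alpha)}S_\alpha^*$ (written $w\sim\sigma$), and $\mathcal P_n^k$ is the set of all such unitaries. For a unitary $u\in\mathcal O_n$, $\lambda_u$ is the unital endomorphism of $\mathcal O_n$ with $\lambda_u(S_i)=u^*S_i$. For $w\sim\sigma\in P_n^k$ and $i\in\{1,\dots,n\}$, the map $f_i^w:W_n^{k-1}\to W_n^{k-1}$ is defined by: $f_i^w(\alpha)=\beta$ iff there is $m\in\{1,\dots,n\}$ with $(i,\alpha)=\sigma(\beta,m)$ (identifying $W_n^k$ with $\{1,\dots,n\}\times W_n^{k-1}$ and with $W_n^{k-1}\times\{1,\dots,n\}$). $\mathcal W_n^{k-1}=\{(\alpha,\beta)\in W_n^{k-1}\times W_n^{k-1}:\alpha\ne\beta\}\cup\{\dagger\}$, with $\dagger$ an extra symbol. For $i,j\in\{1,\dots,n\}$, $f_{ij}^w:\mathcal W_n^{k-1}\to\mathcal W_n^{k-1}$ is defined by $f_{ij}^w(\dagger)=\dagger$; $f_{ij}^w(\alpha,\beta)=(\gamma,\delta)$ if there exists $m\in\{1,\dots,n\}$ with $(i,\alpha)=\sigma(\gamma,m)$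 and $(j,\beta)=\sigma(\delta,m)$ (then automatically $\gamma\neq\delta$); and $f_{ij}^w(\alpha,\beta)=\dagger$ if no such $m,\gamma,\delta$ exist.
   Formalization: In 1(iii) and 2(ii) the relation ≤ is replaced by strict < (in 2(ii) only for elements other than †), because with ≤ the flip σ(a,b)=(b,a), k=2, satisfies both conditions although λ_w is the canonical shift, which is not surjective. *)

theory Defs
  imports Complex_Main "HOL-Combinatorics.Permutations"
begin

section \<open>Unital C*-algebras\<close>

text \<open>Nonzero unital complex C*-algebras. The superclasses supply a complete real unital normed
  algebra with \<open>norm 1 = 1\<close>; \<open>scaleC\<close> is a complex scalar multiplication extending the real one.\<close>

class cstar_algebra = real_normed_algebra_1 + banach +
  fixes scaleC :: "complex \<Rightarrow> 'a \<Rightarrow> 'a"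
    and star :: "'a \<Rightarrow> 'a"
  assumes scaleC_of_real: "scaleC (complex_of_real r) x = r *\<^sub>R x"
    and scaleC_scaleC: "scaleC c (scaleC d x) = scaleC (c * d) x"
    and scaleC_add_left: "scaleC (c + d) x = scaleC c x + scaleC d x"
    and scaleC_add_right: "scaleC c (x + y) = scaleC c x + scaleC c y"
    and scaleC_mult_left: "scaleC c x * y = scaleC c (x * y)"
    and scaleC_mult_right: "x * scaleC c y = scaleC c (x * y)"
    and norm_scaleC: "norm (scaleC c x) = cmod c * norm x"
    and star_star: "star (star x) = x"
    and star_add: "star (x + y) = star x + star y"
    and star_mult: "star (x * y) = star y * star x"
    and star_scaleC: "star (scaleC c x) = scaleC (cnj c) (star x)"
    and cstar_identity: "norm (star x * x) = (norm x)\<^sup>2"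

definition cstar_subalgebra :: "'a::cstar_algebra set \<Rightarrow> bool" where
  "cstar_subalgebra B \<longleftrightarrow>
     closed B \<and> 0 \<in> B \<and>
     (\<forall>x\<in>B. \<forall>y\<in>B. x + y \<in> B \<and> x * y \<in> B) \<and>
     (\<forall>c. \<forall>x\<in>B. scaleC c x \<in> B) \<and>
     (\<forall>x\<in>B. star x \<in> B)"

definition unital_star_endomorphism :: "('a::cstar_algebra \<Rightarrow> 'a) \<Rightarrow> bool" where
  "unital_star_endomorphism \<phi> \<longleftrightarrow>
     (\<forall>x y. \<phi> (x + y) = \<phi> x + \<phi> y) \<and>
     (\<forall>c x. \<phi> (scaleC c x) = scaleC c (\<phi> x)) \<and>
     (\<forall>x y. \<phi> (x * y) = \<phi> x * \<phi> y) \<and>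
     (\<forall>x. \<phi> (star x) = star (\<phi> x)) \<and>
     \<phi> 1 = 1"

definition star_automorphisms :: "('a::cstar_algebra \<Rightarrow> 'a) set" where
  "star_automorphisms = {\<phi>. unital_star_endomorphism \<phi> \<and> bij \<phi>}"


section \<open>The Cuntz algebra\<close>

text \<open>The C*-algebra given by the type \<open>'a\<close> is the Cuntz algebra on \<open>n\<close> generators
  \<open>S 1, \<dots>, S n\<close>. By Cuntz's uniqueness theorem these conditions determine it up to
  isomorphism. The values of \<open>S\<close> outside \<open>{1..n}\<close> are irrelevant.\<close>

definition cuntz_algebra :: "nat \<Rightarrow> (nat \<Rightarrow> 'a::cstar_algebra) \<Rightarrow> bool" where
  "cuntz_algebra n S \<longleftrightarrow>
     (\<forall>i\<in>{1..n}. star (S i) * S i = 1) \<and>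
     (\<Sum>i\<in>{1..n}. S i * star (S i)) = 1 \<and>
     cstar_subalgebra hull (S ` {1..n}) = UNIV"

definition words :: "nat \<Rightarrow> nat \<Rightarrow> nat list set" where
  "words n k = {\<alpha>. length \<alpha> = k \<and> set \<alpha> \<subseteq> {1..n}}"

definition S_word :: "(nat \<Rightarrow> 'a::cstar_algebra) \<Rightarrow> nat list \<Rightarrow> 'a" where
  "S_word S \<alpha> = prod_list (map S \<alpha>)"

definition perm_unitary ::
    "nat \<Rightarrow> nat \<Rightarrow> (nat \<Rightarrow> 'a::cstar_algebra) \<Rightarrow> (nat list \<Rightarrow> nat list) \<Rightarrow> 'a" where
  "perm_unitary n k S \<sigma> = (\<Sum>\<alpha>\<in>words n k. S_word S (\<sigma> \<alpha>) * star (S_word S \<alpha>))"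

text \<open>For \<open>u\<close> unitary in the Cuntz algebra, existence and uniqueness hold by Cuntz's theorem, so
  the description is proper. Note the convention \<open>S i \<mapsto> u\<^sup>* S i\<close> (not \<open>u S i\<close>).\<close>

definition cuntz_endomorphism :: "nat \<Rightarrow> (nat \<Rightarrow> 'a::cstar_algebra) \<Rightarrow> 'a \<Rightarrow> 'a \<Rightarrow> 'a" where
  "cuntz_endomorphism n S u =
     (THE \<phi>. unital_star_endomorphism \<phi> \<and> (\<forall>i\<in>{1..n}. \<phi> (S i) = star u * S i))"


section \<open>The maps on words\<close>

text \<open>Words are lists, so \<open>(i, \<alpha>)\<close> is \<open>i # \<alpha>\<close> and \<open>(\<beta>, m)\<close> is \<open>\<beta> @ [m]\<close>. The map is only meaningful
  for \<open>i \<in> {1..n}\<close> and \<open>\<alpha> \<in> words n (k - 1)\<close>, where the word \<open>\<beta>\<close> exists uniquely.\<close>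

definition f_map ::
    "nat \<Rightarrow> nat \<Rightarrow> (nat list \<Rightarrow> nat list) \<Rightarrow> nat \<Rightarrow> nat list \<Rightarrow> nat list" where
  "f_map n k \<sigma> i \<alpha> =
     (THE \<beta>. \<beta> \<in> words n (k - 1) \<and> (\<exists>m\<in>{1..n}. i # \<alpha> = \<sigma> (\<beta> @ [m])))"

text \<open>The extra symbol \<open>\<dagger>\<close> is \<open>None\<close>; a pair \<open>(\<alpha>, \<beta>)\<close> is \<open>Some (\<alpha>, \<beta>)\<close>.\<close>

definition pairs_dagger :: "nat \<Rightarrow> nat \<Rightarrow> (nat list \<times> nat list) option set" where
  "pairs_dagger n l =
     {Some (\<alpha>, \<beta>) | \<alpha> \<beta>. \<alpha> \<in> words n l \<and> \<beta> \<in> words n l \<and> \<alpha> \<noteq> \<beta>} \<union> {None}"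

definition f2_rel :: "nat \<Rightarrow> nat \<Rightarrow> (nat list \<Rightarrow> nat list) \<Rightarrow> nat \<Rightarrow> nat \<Rightarrow>
    nat list \<times> nat list \<Rightarrow> nat list \<times> nat list \<Rightarrow> bool" where
  "f2_rel n k \<sigma> i j = (\<lambda>(\<alpha>, \<beta>) (\<gamma>, \<delta>).
     \<gamma> \<in> words n (k - 1) \<and> \<delta> \<in> words n (k - 1) \<and>
     (\<exists>m\<in>{1..n}. i # \<alpha> = \<sigma> (\<gamma> @ [m]) \<and> j # \<beta> = \<sigma> (\<delta> @ [m])))"

definition f2_map :: "nat \<Rightarrow> nat \<Rightarrow> (nat list \<Rightarrow> nat list) \<Rightarrow> nat \<Rightarrow> nat \<Rightarrow>
    (nat list \<times> nat list) option \<Rightarrow> (nat list \<times> nat list) option" where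
  "f2_map n k \<sigma> i j x =
     (case x of
        None \<Rightarrow> None
      | Some p \<Rightarrow> if \<exists>q. f2_rel n k \<sigma> i j p q then Some (THE q. f2_rel n k \<sigma> i j p q) else None)"

text \<open>Orders are reflexive relations \<open>r\<close>, with \<open>(x, y) \<in> r\<close> meaning \<open>x \<le> y\<close> and
  \<open>(x, y) \<in> r - Id\<close> meaning \<open>x < y\<close>. The descent conditions on \<open>f_map\<close> and \<open>f2_map\<close> have to be
  read strictly. With \<open>\<le>\<close> the criterion fails: for \<open>\<sigma> [a, b] = [b, a]\<close> every \<open>f_map n 2 \<sigma> i\<close> is the
  identity and \<open>f2_map n 2 \<sigma> i j\<close> is the identity for \<open>i = j\<close> and constantly \<open>None\<close> otherwise, so
  non-strict descent is possible, while the endomorphism is the canonical shift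
  \<open>x \<mapsto> \<Sum>i. S i * x * star (S i)\<close>, which is not surjective.\<close>

definition minimal_in :: "'b set \<Rightarrow> 'b rel \<Rightarrow> 'b \<Rightarrow> bool" where
  "minimal_in A r x \<longleftrightarrow> x \<in> A \<and> (\<forall>y\<in>A. (y, x) \<in> r \<longrightarrow> y = x)"

end

theory Submission
  imports Defs "HOL-Analysis.Analysis"
begin

text \<open>
  Put \<open>T i = star w * S i\<close>. This is again a Cuntz family, and the endomorphism maps \<open>S i\<close> to \<open>T i\<close>.
  That it exists is Cuntz's theorem, which has an elementary proof. A polynomial in a Cuntz family
  is a sum of homogeneous components. Compressing by suitable isometries shows that each component
  has at most the norm of the polynomial (\<open>norm_component_le\<close>), and homogeneous components reduce to
  matrix algebras, where norms in two families differ by at most a constant factor. Since the number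
  of components of a power grows linearly, while \<open>norm (x ^ m)\<close> is \<open>norm x ^ m\<close> for selfadjoint \<open>x\<close>
  and \<open>m\<close> a power of two, all such factors disappear, and corresponding polynomials in two Cuntz
  families have equal norms (\<open>norm_level_pair_eq\<close>). So the endomorphism exists and is isometric; it
  is unique because endomorphisms are automatically contractive. Hence it is an automorphism iff it
  is surjective.

  Write \<open>k = l + 1\<close> and let \<open>L\<close> be the span of the \<open>S \<mu> * star (S \<nu>)\<close> with words of length \<open>l\<close>, a
  matrix algebra. The key computation (\<open>T_compression\<close>) is that \<open>x \<mapsto> star (T i) * x * T j\<close> maps \<open>L\<close>
  to itself, and that the entry of the result at \<open>(\<alpha>, \<beta>)\<close> is the entry of \<open>x\<close> at
  \<open>f2_map n k \<sigma> i j (\<alpha>, \<beta>)\<close>, read as \<open>0\<close> if the latter is \<open>None\<close>. If all compressions of \<open>L\<close> by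
  \<open>T\<close>-words of some length are scalars, then expanding along these words shows that \<open>L\<close> lies in the
  range; then so do \<open>w\<close>, whose compressions by \<open>T i\<close> and \<open>T j\<close> lie in \<open>L\<close>, and the generators
  \<open>S i = w * T i\<close>. Conversely, if the endomorphism is surjective, an element of \<open>L\<close> is close to a
  polynomial in the \<open>T i\<close>, hence by homogeneity to a polynomial of degree zero, and long compressions
  of that are scalars. The compressions of matrix units have entries \<open>0\<close> and \<open>1\<close>, so that they must
  be scalars once they are close enough to scalars.

  Thus surjectivity means that all sufficiently long composites of the maps on pairs send every
  off-diagonal pair to \<open>None\<close> and are constant on the diagonal. A composite with equal indices acts
  on the diagonal by the maps \<open>f_map\<close>, while at different indices the diagonal is left and never
  reached again. So the condition is that long composites of the \<open>f_map n k \<sigma> i\<close> are constant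
  (\<open>merging\<close>) and that long composites of the \<open>f2_map n k \<sigma> i j\<close> send off-diagonal pairs to \<open>None\<close>
  (\<open>separating\<close>). On a finite set, reaching a sink after boundedly many steps is the same as having
  an order in which every step outside the sink strictly descends.
\<close>

section \<open>Elementary facts about C*-algebras\<close>

lemma scaleC_one [simp]: "scaleC 1 x = (x::'a::cstar_algebra)"
  using scaleC_of_real[of 1 x] by simp

lemma scaleC_zero_left [simp]: "scaleC 0 x = (0::'a::cstar_algebra)"
  using scaleC_of_real[of 0 x] by simp

lemma scaleC_zero_right [simp]: "scaleC c 0 = (0::'a::cstar_algebra)"
  using scaleC_add_right[of c "0::'a" 0] by simp

lemma scaleC_minus_right: "scaleC c (- x) = - scaleC c (x::'a::cstar_algebra)"
  using scaleC_add_right[of c x "- x"] by (simp add: eq_neg_iff_add_eq_0 add.commute)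

lemma scaleC_minus_left: "scaleC (- c) x = - scaleC c (x::'a::cstar_algebra)"
  using scaleC_add_left[of c "- c" x] by (simp add: eq_neg_iff_add_eq_0 add.commute)

lemma scaleC_diff_right: "scaleC c (x - y) = scaleC c x - scaleC c (y::'a::cstar_algebra)"
  using scaleC_add_right[of c x "- y"] by (simp add: scaleC_minus_right)

lemma scaleC_diff_left: "scaleC (c - d) x = scaleC c x - scaleC d (x::'a::cstar_algebra)"
  using scaleC_add_left[of c "- d" x] by (simp add: scaleC_minus_left)

lemma scaleC_sum_right: "scaleC c (\<Sum>i\<in>I. f i) = (\<Sum>i\<in>I. scaleC c (f i :: 'a::cstar_algebra))"
  by (induction I rule: infinite_finite_induct) (auto simp: scaleC_add_right)

lemma scaleC_sum_left: "scaleC (\<Sum>i\<in>I. f i) x = (\<Sum>i\<in>I. scaleC (f i) (x :: 'a::cstar_algebra))"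
  by (induction I rule: infinite_finite_induct) (auto simp: scaleC_add_left)

lemma star_zero [simp]: "star 0 = (0::'a::cstar_algebra)"
  using star_add[of "0::'a" 0] by simp

lemma star_one [simp]: "star 1 = (1::'a::cstar_algebra)"
  by (metis mult.right_neutral star_mult star_star mult.left_neutral)

lemma star_minus: "star (- x) = - star (x::'a::cstar_algebra)"
  using star_add[of x "- x"] by (simp add: eq_neg_iff_add_eq_0 add.commute)

lemma star_diff: "star (x - y) = star x - star (y::'a::cstar_algebra)"
  using star_add[of x "- y"] by (simp add: star_minus)

lemma star_scaleR: "star (r *\<^sub>R x) = r *\<^sub>R star (x::'a::cstar_algebra)"
  by (metis scaleC_of_real star_scaleC complex_cnj_complex_of_real)

lemma star_sum: "star (\<Sum>i\<in>I. f i) = (\<Sum>i\<in>I. star (f i :: 'a::cstar_algebra))"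
  by (induction I rule: infinite_finite_induct) (auto simp: star_add)

lemma star_power: "star (x ^ m) = star (x::'a::cstar_algebra) ^ m"
  by (induction m) (auto simp: star_mult power_commutes)

lemma star_eq_zero_iff [simp]: "star x = 0 \<longleftrightarrow> (x::'a::cstar_algebra) = 0"
  by (metis star_star star_zero)

lemma norm_star [simp]: "norm (star x) = norm (x::'a::cstar_algebra)"
proof -
  have le: "norm y \<le> norm (star y)" for y :: 'a
  proof (cases "y = 0")
    case False
    have "norm y * norm y \<le> norm (star y) * norm y"
      using norm_mult_ineq[of "star y" y] by (simp add: cstar_identity power2_eq_square)
    with False show ?thesis
      by simp
  qed simp
  show ?thesis
    using le[of x] le[of "star x"] by (simp add: star_star)
qed

lemma star_mult_self_eq_zero: "star x * x = 0 \<Longrightarrow> (x::'a::cstar_algebra) = 0"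
  using cstar_identity[of x] by simp

lemma norm_mult3_le: "norm (x * y * z) \<le> norm x * norm y * norm (z::'a::real_normed_algebra)"
proof -
  have "norm (x * y * z) \<le> norm (x * y) * norm z"
    by (rule norm_mult_ineq)
  also have "\<dots> \<le> norm x * norm y * norm z"
    by (intro mult_right_mono norm_mult_ineq norm_ge_zero)
  finally show ?thesis .
qed

lemma norm_isometry: "star v * v = 1 \<Longrightarrow> norm (v::'a::cstar_algebra) = 1"
  using cstar_identity[of v] norm_ge_zero[of v] by (auto simp: power2_eq_1_iff)

lemma bounded_linear_star: "bounded_linear (star :: 'a::cstar_algebra \<Rightarrow> 'a)"
  by (rule bounded_linear_intro[where K = 1]) (auto simp: star_add star_scaleR)

lemma bounded_linear_scaleC: "bounded_linear (scaleC c :: 'a::cstar_algebra \<Rightarrow> 'a)"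
proof (rule bounded_linear_intro[where K = "cmod c"])
  fix r and x :: 'a
  show "scaleC c (r *\<^sub>R x) = r *\<^sub>R scaleC c x"
    by (metis scaleC_of_real scaleC_scaleC mult.commute)
qed (auto simp: scaleC_add_right norm_scaleC)

lemma norm_selfadjoint_power:
  assumes "star h = (h::'a::cstar_algebra)"
  shows "norm (h ^ (2 ^ j)) = norm h ^ (2 ^ j)"
proof (induction j)
  case (Suc j)
  let ?g = "h ^ (2 ^ j)"
  have "h ^ (2 ^ Suc j) = star ?g * ?g"
    by (simp add: star_power assms power_add mult_2)
  then have "norm (h ^ (2 ^ Suc j)) = (norm ?g)\<^sup>2"
    by (simp add: cstar_identity)
  also have "\<dots> = norm h ^ (2 ^ j * 2)"
    by (simp only: Suc power_mult)
  finally show ?case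
    by (simp only: power_Suc2)
qed simp

subsection \<open>Square roots\<close>

lemma abs_gbinomial_half_le_one: "\<bar>(1/2::real) gchoose k\<bar> \<le> 1"
proof (induction k)
  case (Suc k)
  have "real (Suc k) * ((1/2) gchoose (Suc k)) = (1/2 - real k) * ((1/2) gchoose k)"
    using gbinomial_mult_1[of "1/2::real" k] by (simp add: algebra_simps)
  then have "(1/2::real) gchoose (Suc k) = (1/2 - real k) / real (Suc k) * ((1/2) gchoose k)"
    by (simp add: field_simps)
  moreover have "\<bar>(1/2 - real k) / real (Suc k)\<bar> \<le> 1"
    by (simp add: divide_le_eq abs_le_iff)
  ultimately show ?case
    using Suc.IH by (metis abs_ge_zero abs_mult mult_le_one)
qed simp

text \<open>The square root is the binomial series \<open>\<Sum>k. (1/2 gchoose k) * (- x) ^ k\<close>: its square is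
  computed by Vandermonde's identity, and a limit of polynomials in \<open>x\<close> inherits selfadjointness
  and commutation relations from \<open>x\<close>.\<close>

lemma selfadjoint_sqrt:
  fixes x :: "'a::cstar_algebra"
  assumes x: "star x = x" "norm x < 1"
  obtains y where "star y = y" "y * y = 1 - x" "\<And>z. z * x = x * z \<Longrightarrow> z * y = y * z"
proof -
  define c where "c k = ((1/2::real) gchoose k)" for k
  define f where "f k = c k *\<^sub>R (- x) ^ k" for k
  have nf: "norm (f k) \<le> norm x ^ k" for k
  proof -
    have "norm (f k) \<le> \<bar>c k\<bar> * norm ((- x) ^ k)"
      by (simp add: f_def)
    also have "\<dots> \<le> 1 * norm (- x) ^ k"
      by (intro mult_mono norm_power_ineq) (auto simp: c_def abs_gbinomial_half_le_one)
    finally show ?thesis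
      by simp
  qed
  have sn: "summable (\<lambda>k. norm (f k))"
    by (rule summable_comparison_test[OF _ summable_geometric[of "norm x"]])
      (use nf x in auto)
  then have s: "summable f"
    by (rule summable_norm_cancel)
  define y where "y = (\<Sum>k. f k)"
  have "star y = y"
  proof -
    have "star (f k) = f k" for k
      by (simp add: f_def star_scaleR star_power star_minus x)
    then show ?thesis
      unfolding y_def using bounded_linear.suminf[OF bounded_linear_star s] by simp
  qed
  moreover have "y * y = 1 - x"
  proof -
    have eq: "(\<Sum>i\<le>k. f i * f (k - i)) = (1 gchoose k) *\<^sub>R (- x) ^ k" for k
    proof -
      have "(\<Sum>i\<le>k. f i * f (k - i)) = (\<Sum>i\<le>k. (c i * c (k - i)) *\<^sub>R (- x) ^ k)"
        by (intro sum.cong refl) (simp add: f_def flip: power_add)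
      also have "\<dots> = (\<Sum>i=0..k. c i * c (k - i)) *\<^sub>R (- x) ^ k"
        by (simp add: scaleR_sum_left atMost_atLeast0)
      also have "(\<Sum>i=0..k. c i * c (k - i)) = 1 gchoose k"
        unfolding c_def gbinomial_Vandermonde by simp
      finally show ?thesis .
    qed
    have "y * y = (\<Sum>k. (1 gchoose k) *\<^sub>R (- x) ^ k)"
      unfolding y_def Cauchy_product[OF sn sn] eq ..
    also have "\<dots> = (\<Sum>k\<in>{0, 1}. (1 gchoose k) *\<^sub>R (- x) ^ k)"
    proof (rule suminf_finite)
      fix k :: nat
      assume "k \<notin> {0, 1}"
      then have "1 choose k = 0"
        by (intro binomial_eq_0) auto
      then have "(1::real) gchoose k = 0"
        using binomial_gbinomial[of 1 k, where ?'a = real] by (metis of_nat_0 of_nat_1)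
      then show "((1::real) gchoose k) *\<^sub>R (- x) ^ k = 0"
        by simp
    qed simp
    finally show ?thesis
      by simp
  qed
  moreover have "z * y = y * z" if "z * x = x * z" for z
  proof -
    have "z * (- x) ^ k = (- x) ^ k * z" for k
      by (rule power_commuting_commutes[symmetric]) (simp add: that)
    then have "z * f k = f k * z" for k
      by (simp add: f_def)
    then show ?thesis
      unfolding y_def by (simp add: suminf_mult2[OF s] flip: suminf_mult[OF s])
  qed
  ultimately show ?thesis
    using that by blast
qed

text \<open>If \<open>x\<close> and \<open>y\<close> are commuting and selfadjoint, then \<open>u = x + \<i> y\<close> satisfies
  \<open>u\<^sup>* u = x\<^sup>2 + y\<^sup>2\<close>, and \<open>x\<close> is the real part of \<open>u\<close>.\<close>

lemma norm_le_of_commuting_squares: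
  fixes x y :: "'a::cstar_algebra"
  assumes "star x = x" "star y = y" "x * y = y * x" "norm (x * x + y * y) \<le> r\<^sup>2" "r \<ge> 0"
  shows "norm x \<le> r"
proof -
  define u where "u = x + scaleC \<i> y"
  have su: "star u = x - scaleC \<i> y"
    by (simp add: u_def star_add star_scaleC assms scaleC_minus_left)
  have "star u * u = x * x + y * y"
    unfolding su unfolding u_def
    by (simp add: algebra_simps scaleC_mult_left scaleC_mult_right scaleC_scaleC assms(3)
        scaleC_minus_left scaleC_diff_right)
  then have "(norm u)\<^sup>2 \<le> r\<^sup>2"
    using assms cstar_identity[of u] by simp
  then have "norm u \<le> r"
    using assms by (metis power2_le_imp_le)
  moreover have "2 *\<^sub>R x = u + star u"
    unfolding su by (simp add: u_def scaleR_2)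
  then have "2 * norm x \<le> norm u + norm (star u)"
    by (metis norm_scaleR norm_triangle_ineq abs_numeral)
  ultimately show ?thesis
    by simp
qed

text \<open>A selfadjoint \<open>x\<close> in the open unit ball is the real part of the unitary
  \<open>x + \<i> sqrt (1 - x\<^sup>2)\<close>; as endomorphisms preserve this description, they are contractive.\<close>

lemma unital_star_endomorphism_norm_le:
  fixes \<phi> :: "'a::cstar_algebra \<Rightarrow> 'a"
  assumes "unital_star_endomorphism \<phi>"
  shows "norm (\<phi> x) \<le> norm x"
proof -
  have add: "\<phi> (x + y) = \<phi> x + \<phi> y" and sc: "\<phi> (scaleC c x) = scaleC c (\<phi> x)"
    and mult: "\<phi> (x * y) = \<phi> x * \<phi> y" and st: "\<phi> (star x) = star (\<phi> x)"
    and one: "\<phi> 1 = 1" for x y c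
    using assms by (auto simp: unital_star_endomorphism_def)
  have scR: "\<phi> (r *\<^sub>R x) = r *\<^sub>R \<phi> x" for r x
    by (metis sc scaleC_of_real)
  have unit: "norm (\<phi> x) \<le> 1" if x: "star x = x" "norm x < 1" for x
  proof -
    have "norm (x * x) < 1"
      using x norm_mult_ineq[of x x] by (metis cstar_identity power2_eq_square mult_strict_mono norm_ge_zero mult_1 zero_less_one)
    then obtain y where y: "star y = y" "y * y = 1 - x * x" "\<And>z. z * (x * x) = x * x * z \<Longrightarrow> z * y = y * z"
      using selfadjoint_sqrt[of "x * x"] x by (metis star_mult)
    have "x * x + y * y = 1" "x * y = y * x"
      using y by (auto simp: mult.assoc)
    then have "\<phi> x * \<phi> x + \<phi> y * \<phi> y = 1" "\<phi> x * \<phi> y = \<phi> y * \<phi> x"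
      by (metis add mult one)+
    then show ?thesis
      using norm_le_of_commuting_squares[of "\<phi> x" "\<phi> y" 1] x y by (metis st norm_one one_power2 order_refl zero_le_one)
  qed
  have sa: "norm (\<phi> x) \<le> norm x" if x: "star x = x" for x
  proof (rule dense_ge)
    fix r
    assume r: "norm x < r"
    then have "r > 0"
      using norm_ge_zero[of x] by linarith
    have "norm (\<phi> ((1 / r) *\<^sub>R x)) \<le> 1"
      by (rule unit) (use x r \<open>r > 0\<close> in \<open>auto simp: star_scaleR\<close>)
    then show "norm (\<phi> x) \<le> r"
      using \<open>r > 0\<close> by (simp add: scR)
  qed
  have "norm (\<phi> (star x * x)) \<le> norm (star x * x)"
    by (rule sa) (simp add: star_mult star_star)
  then have "(norm (\<phi> x))\<^sup>2 \<le> (norm x)\<^sup>2"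
    by (simp add: mult st cstar_identity)
  then show ?thesis
    by (rule power2_le_imp_le) simp
qed

text \<open>The unit is an extreme point of the unit ball. For \<open>\<epsilon> > 0\<close> both \<open>\<epsilon> + g\<close> and
  \<open>\<epsilon> - g\<close> are squares \<open>y\<^sup>2\<close> and \<open>z\<^sup>2\<close> of commuting selfadjoint elements; as \<open>y\<^sup>2 + z\<^sup>2 = 2 \<epsilon>\<close>, these
  squares have norm at most \<open>2 \<epsilon>\<close>. \<close>

lemma selfadjoint_zero_of_norms_le:
  fixes g :: "'a::cstar_algebra"
  assumes g: "star g = g" and t: "t > 0" "norm (t *\<^sub>R 1 - g) \<le> t" "norm (t *\<^sub>R 1 + g) \<le> t"
  shows "g = 0"
proof -
  have sqrt: "\<exists>y. star y = y \<and> y * y = h + e *\<^sub>R 1 \<and> (\<forall>z. z * h = h * z \<longrightarrow> z * y = y * z)"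
    if h: "star h = h" "norm (t *\<^sub>R 1 - h) \<le> t" and e: "e > 0" for h :: 'a and e
  proof -
    define x where "x = (1 / (t + e)) *\<^sub>R (t *\<^sub>R 1 - h)"
    have te: "t + e > 0"
      using t e by simp
    have "star x = x"
      by (simp add: x_def star_scaleR star_diff h)
    moreover have "norm x < 1"
      using te h e by (simp add: x_def)
    ultimately obtain y where y: "star y = y" "y * y = 1 - x" "\<And>z. z * x = x * z \<Longrightarrow> z * y = y * z"
      using selfadjoint_sqrt by blast
    define y' where "y' = sqrt (t + e) *\<^sub>R y"
    have "y' * y' = (sqrt (t + e) * sqrt (t + e)) *\<^sub>R (y * y)"
      by (simp add: y'_def)
    also have "\<dots> = (t + e) *\<^sub>R (1 - x)"
      using te y(2) by simp
    also have "\<dots> = h + e *\<^sub>R 1"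
      using te by (simp add: x_def scaleR_diff_right scaleR_left_distrib)
    finally have "y' * y' = h + e *\<^sub>R 1" .
    moreover have "z * y' = y' * z" if "z * h = h * z" for z
    proof -
      have "z * x = x * z"
        using that by (simp add: x_def right_diff_distrib left_diff_distrib)
      then show ?thesis
        by (simp add: y'_def y(3))
    qed
    moreover have "star y' = y'"
      by (simp add: y'_def star_scaleR y)
    ultimately show ?thesis
      by blast
  qed
  have le: "norm g \<le> 3 * e" if e: "e > 0" for e
  proof -
    obtain y where y: "star y = y" "y * y = g + e *\<^sub>R 1" "\<And>z. z * g = g * z \<Longrightarrow> z * y = y * z"
      using sqrt[OF g t(2) e] by blast
    obtain z where z: "star z = z" "z * z = - g + e *\<^sub>R 1" "\<And>w. w * (- g) = - g * w \<Longrightarrow> w * z = z * w"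
    proof -
      have "star (- g) = - g" "norm (t *\<^sub>R 1 - - g) \<le> t"
        using g t(3) by (simp_all add: star_minus)
      from sqrt[OF this e] show thesis
        using that by blast
    qed
    have "g * y = y * g"
      by (simp add: y(3))
    then have comm: "y * z = z * y"
      by (intro z(3)) simp
    have "y * y + z * z = (2 * e) *\<^sub>R 1"
      by (simp add: y(2) z(2) scaleR_2 flip: scaleR_scaleR)
    then have sum: "norm (y * y + z * z) \<le> (sqrt (2 * e))\<^sup>2"
      using e by simp
    have "norm y \<le> sqrt (2 * e)"
      by (rule norm_le_of_commuting_squares[OF y(1) z(1) comm sum]) (use e in simp)
    then have "(norm y)\<^sup>2 \<le> (sqrt (2 * e))\<^sup>2"
      by (intro power_mono) auto
    then have "(norm y)\<^sup>2 \<le> 2 * e"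
      using e by simp
    then have "norm (g + e *\<^sub>R 1) \<le> 2 * e"
      using cstar_identity[of y] y(1,2) by simp
    moreover have "norm g \<le> norm (g + e *\<^sub>R 1) + norm (e *\<^sub>R (1::'a))"
      by (metis add_diff_cancel_right' norm_triangle_ineq4)
    ultimately show ?thesis
      using e by simp
  qed
  have "norm g \<le> e" if "e > 0" for e
    using le[of "e / 3"] that by simp
  then have "norm g \<le> 0"
    by (rule dense_ge)
  then show ?thesis
    by simp
qed

section \<open>Cuntz families\<close>

lemma finite_words [simp]: "finite (words n k)"
proof -
  have "words n k = {\<alpha>. set \<alpha> \<subseteq> {1..n} \<and> length \<alpha> = k}"
    by (auto simp: words_def)
  then show ?thesis
    using finite_lists_length_eq[of "{1..n}" k] by simp
qed

lemma words_0 [simp]: "words n 0 = {[]}"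
  by (auto simp: words_def)

lemma Cons_in_words [simp]: "i # \<alpha> \<in> words n (Suc k) \<longleftrightarrow> i \<in> {1..n} \<and> \<alpha> \<in> words n k"
  by (auto simp: words_def)

lemma snoc_in_words [simp]: "\<alpha> @ [m] \<in> words n (Suc k) \<longleftrightarrow> m \<in> {1..n} \<and> \<alpha> \<in> words n k"
  by (auto simp: words_def)

lemma append_in_words: "\<alpha> \<in> words n a \<Longrightarrow> \<beta> \<in> words n b \<Longrightarrow> \<alpha> @ \<beta> \<in> words n (a + b)"
  by (auto simp: words_def)

lemma words_SucE_Cons:
  assumes "\<alpha> \<in> words n (Suc k)"
  obtains i \<beta> where "\<alpha> = i # \<beta>" "i \<in> {1..n}" "\<beta> \<in> words n k"
  using assms by (cases \<alpha>) (auto simp: words_def)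

lemma words_SucE_snoc:
  assumes "\<alpha> \<in> words n (Suc k)"
  obtains \<beta> m where "\<alpha> = \<beta> @ [m]" "m \<in> {1..n}" "\<beta> \<in> words n k"
  using assms by (cases \<alpha> rule: rev_cases) (auto simp: words_def)

lemma sum_words_Suc:
  "(\<Sum>\<alpha>\<in>words n (Suc k). f \<alpha>) = (\<Sum>i\<in>{1..n}. \<Sum>\<alpha>\<in>words n k. f (i # \<alpha>))"
proof -
  have "words n (Suc k) = (\<lambda>(i, \<alpha>). i # \<alpha>) ` ({1..n} \<times> words n k)"
    by (auto elim!: words_SucE_Cons)
  then have "(\<Sum>\<alpha>\<in>words n (Suc k). f \<alpha>) = (\<Sum>(i, \<alpha>)\<in>{1..n} \<times> words n k. f (i # \<alpha>))"
    by (simp add: sum.reindex inj_on_def case_prod_unfold)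
  then show ?thesis
    by (simp add: sum.cartesian_product)
qed

lemma S_word_Nil [simp]: "S_word S [] = 1"
  by (simp add: S_word_def)

lemma S_word_Cons [simp]: "S_word S (i # \<alpha>) = S i * S_word S \<alpha>"
  by (simp add: S_word_def)

lemma S_word_append: "S_word S (\<alpha> @ \<beta>) = S_word S \<alpha> * S_word S \<beta>"
  by (simp add: S_word_def)

definition word_comb ::
    "nat \<Rightarrow> (nat \<Rightarrow> 'a::cstar_algebra) \<Rightarrow> nat \<Rightarrow> nat \<Rightarrow> (nat list \<Rightarrow> nat list \<Rightarrow> complex) \<Rightarrow> 'a" where
  "word_comb n S a b c =
     (\<Sum>\<alpha>\<in>words n a. \<Sum>\<beta>\<in>words n b. scaleC (c \<alpha> \<beta>) (S_word S \<alpha> * star (S_word S \<beta>)))"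

lemma word_comb_cong:
  "(\<And>\<alpha> \<beta>. \<alpha> \<in> words n a \<Longrightarrow> \<beta> \<in> words n b \<Longrightarrow> c \<alpha> \<beta> = d \<alpha> \<beta>) \<Longrightarrow>
    word_comb n S a b c = word_comb n S a b d"
  by (simp add: word_comb_def)

locale cuntz_family =
  fixes n :: nat and S :: "nat \<Rightarrow> 'a::cstar_algebra"
  assumes two_le_n: "2 \<le> n"
    and isometry: "i \<in> {1..n} \<Longrightarrow> star (S i) * S i = 1"
    and sum_ranges: "(\<Sum>i\<in>{1..n}. S i * star (S i)) = 1"
begin

text \<open>Compress the identity \<open>\<Sum>i. S i * star (S i) = 1\<close> by \<open>S j\<close>: the elements
  \<open>g i = star (S j) * S i * star (S i) * S j\<close> with \<open>i \<noteq> j\<close> sum to zero. Being compressions of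
  projections, they satisfy \<open>norm (1 - g i) \<le> 1\<close>, which is how positivity enters, and therefore
  they all vanish.\<close>

lemma isometries_orthogonal:
  assumes ij: "i \<in> {1..n}" "j \<in> {1..n}" "i \<noteq> j"
  shows "star (S i) * S j = 0"
proof -
  define g where "g l = star (S j) * (S l * star (S l)) * S j" for l
  have norm_g: "norm (1 - g l) \<le> 1" if l: "l \<in> {1..n}" for l
  proof -
    define q where "q = 1 - S l * star (S l)"
    have pp: "S l * star (S l) * (S l * star (S l)) = S l * star (S l)"
      using isometry[OF l] by (metis mult.assoc mult.right_neutral)
    have "star q = q" "q * q = q"
      using pp by (simp_all add: q_def star_diff star_mult star_star left_diff_distrib right_diff_distrib)
    then have "(norm q)\<^sup>2 = norm q"
      using cstar_identity[of q] by simp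
    then have "norm q \<le> 1"
      by (auto simp: power2_eq_square)
    have "1 - g l = star (S j) * q * S j"
      using isometry[OF ij(2)] by (simp add: g_def q_def algebra_simps)
    then have "norm (1 - g l) \<le> norm (star (S j)) * norm q * norm (S j)"
      using norm_mult3_le by metis
    then show ?thesis
      using \<open>norm q \<le> 1\<close> norm_isometry[OF isometry[OF ij(2)]] by simp
  qed
  define R where "R = {1..n} - {j} - {i}"
  have "(\<Sum>l\<in>{1..n}. g l) = star (S j) * (\<Sum>l\<in>{1..n}. S l * star (S l)) * S j"
    by (simp add: g_def sum_distrib_left sum_distrib_right)
  also have "\<dots> = 1"
    by (simp only: sum_ranges isometry[OF ij(2)] mult_1_right)
  finally have "(\<Sum>l\<in>{1..n}. g l) = 1" .
  moreover have "(\<Sum>l\<in>{1..n}. g l) = g j + (g i + (\<Sum>l\<in>R. g l))"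
    using ij sum.remove[of "{1..n}" j g] sum.remove[of "{1..n} - {j}" i g] by (simp add: R_def)
  moreover have "g j = 1"
    using isometry[OF ij(2)] by (simp add: g_def mult.assoc)
  ultimately have gi: "g i = - (\<Sum>l\<in>R. g l)"
    by (metis add_left_cancel add_0_right eq_neg_iff_add_eq_0)
  define t where "t = 1 + real (card R)"
  have "norm (t *\<^sub>R 1 - g i) = norm ((1 - g i) + real (card R) *\<^sub>R 1)"
    by (simp add: t_def scaleR_left_distrib algebra_simps)
  also have "\<dots> \<le> t"
    using norm_triangle_ineq[of "1 - g i" "real (card R) *\<^sub>R 1"] norm_g[OF ij(1)] by (simp add: t_def)
  finally have t1: "norm (t *\<^sub>R 1 - g i) \<le> t" .
  have "t *\<^sub>R 1 + g i = 1 + (\<Sum>l\<in>R. 1 - g l)"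
    by (simp add: gi t_def scaleR_left_distrib sum_subtractf scaleR_conv_of_real)
  moreover have "norm (\<Sum>l\<in>R. 1 - g l) \<le> real (card R)"
    using sum_norm_le[of R "\<lambda>l. 1 - g l" "\<lambda>_. 1"] norm_g by (auto simp: R_def)
  ultimately have t2: "norm (t *\<^sub>R 1 + g i) \<le> t"
    using norm_triangle_ineq[of 1 "\<Sum>l\<in>R. 1 - g l"] by (simp add: t_def)
  have sg: "star (g i) = g i"
    by (simp add: g_def star_mult star_star mult.assoc)
  have "g i = 0"
    by (rule selfadjoint_zero_of_norms_le[OF sg _ t1 t2]) (simp add: t_def)
  then have "star (star (S i) * S j) * (star (S i) * S j) = 0"
    by (simp add: g_def star_mult star_star mult.assoc)
  then show ?thesis
    by (rule star_mult_self_eq_zero)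
qed

lemma S_word_isometry: "set \<alpha> \<subseteq> {1..n} \<Longrightarrow> star (S_word S \<alpha>) * S_word S \<alpha> = 1"
proof (induction \<alpha>)
  case (Cons i \<alpha>)
  then have "star (S i) * S i = 1"
    by (intro isometry) auto
  then have "star (S i) * (S i * S_word S \<alpha>) = S_word S \<alpha>"
    by (simp flip: mult.assoc)
  with Cons show ?case
    by (simp add: star_mult mult.assoc)
qed simp

lemma S_word_orthogonal:
  assumes "set \<alpha> \<subseteq> {1..n}" "set \<beta> \<subseteq> {1..n}" "p < length \<alpha>" "p < length \<beta>" "\<alpha> ! p \<noteq> \<beta> ! p"
  shows "star (S_word S \<alpha>) * S_word S \<beta> = 0"
  using assms
proof (induction \<alpha> arbitrary: \<beta> p)
  case (Cons i \<alpha>)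
  then obtain j \<gamma> where \<beta>: "\<beta> = j # \<gamma>"
    by (cases \<beta>) auto
  have eq: "star (S_word S (i # \<alpha>)) * S_word S \<beta> = star (S_word S \<alpha>) * (star (S i) * S j) * S_word S \<gamma>"
    by (simp add: \<beta> star_mult mult.assoc)
  show ?case
  proof (cases "i = j")
    case True
    then obtain p' where "p = Suc p'"
      using Cons.prems \<beta> by (cases p) auto
    then show ?thesis
      using Cons.prems Cons.IH[of \<gamma> p'] \<beta> True isometry[of j] unfolding eq by simp
  next
    case False
    then show ?thesis
      using Cons.prems \<beta> isometries_orthogonal[of i j] unfolding eq by simp
  qed
qed simp

lemma S_word_star_mult:
  assumes "\<alpha> \<in> words n a" "\<beta> \<in> words n a"
  shows "star (S_word S \<alpha>) * S_word S \<beta> = (if \<alpha> = \<beta> then 1 else 0)"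
proof (cases "\<alpha> = \<beta>")
  case True
  then show ?thesis
    using assms S_word_isometry by (auto simp: words_def)
next
  case False
  then obtain p where "p < a" "\<alpha> ! p \<noteq> \<beta> ! p"
    using assms nth_equalityI[of \<alpha> \<beta>] by (auto simp: words_def)
  then show ?thesis
    using assms False S_word_orthogonal[of \<alpha> \<beta> p] by (auto simp: words_def)
qed

lemma sum_word_ranges: "(\<Sum>\<alpha>\<in>words n a. S_word S \<alpha> * star (S_word S \<alpha>)) = 1"
proof (induction a)
  case (Suc a)
  have "(\<Sum>\<alpha>\<in>words n (Suc a). S_word S \<alpha> * star (S_word S \<alpha>)) =
      (\<Sum>i\<in>{1..n}. S i * (\<Sum>\<alpha>\<in>words n a. S_word S \<alpha> * star (S_word S \<alpha>)) * star (S i))"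
    by (simp add: sum_words_Suc star_mult sum_distrib_left sum_distrib_right mult.assoc)
  also have "\<dots> = (\<Sum>i\<in>{1..n}. S i * star (S i))"
    by (simp add: Suc)
  finally show ?case
    by (simp only: sum_ranges)
qed simp

subsection \<open>Matrix units\<close>

text \<open>The elements \<open>S_word S \<alpha> * star (S_word S \<beta>)\<close> with words of given lengths behave like matrix
  units: the coefficients of a combination are its compressions, and conversely an element with
  scalar compressions is a combination. The algebraic rules for \<open>word_comb\<close> are all derived by
  comparing compressions.\<close>

lemma word_comb_entry:
  assumes "\<alpha> \<in> words n a" "\<beta> \<in> words n b"
  shows "star (S_word S \<alpha>) * word_comb n S a b c * S_word S \<beta> = scaleC (c \<alpha> \<beta>) 1"
proof -
  have "star (S_word S \<alpha>) * word_comb n S a b c * S_word S \<beta> =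
     (\<Sum>\<gamma>\<in>words n a. \<Sum>\<delta>\<in>words n b. scaleC (c \<gamma> \<delta>)
        ((star (S_word S \<alpha>) * S_word S \<gamma>) * (star (S_word S \<delta>) * S_word S \<beta>)))"
    by (simp add: word_comb_def sum_distrib_left sum_distrib_right scaleC_mult_left
        scaleC_mult_right mult.assoc)
  also have "\<dots> = (\<Sum>\<gamma>\<in>words n a. \<Sum>\<delta>\<in>words n b. if \<gamma> = \<alpha> then if \<delta> = \<beta> then scaleC (c \<gamma> \<delta>) 1 else 0 else 0)"
    by (intro sum.cong refl)
      (auto simp: S_word_star_mult[OF assms(1)] S_word_star_mult[OF _ assms(2)] split: if_splits)
  also have "\<dots> = (\<Sum>\<gamma>\<in>words n a. if \<gamma> = \<alpha> then scaleC (c \<gamma> \<beta>) 1 else 0)"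
    by (intro sum.cong refl) (simp add: assms)
  also have "\<dots> = scaleC (c \<alpha> \<beta>) 1"
    using assms by simp
  finally show ?thesis .
qed

lemma word_expansion:
  "x = (\<Sum>\<alpha>\<in>words n a. \<Sum>\<beta>\<in>words n b.
      S_word S \<alpha> * (star (S_word S \<alpha>) * x * S_word S \<beta>) * star (S_word S \<beta>))"
proof -
  have "x = (\<Sum>\<alpha>\<in>words n a. S_word S \<alpha> * star (S_word S \<alpha>)) * x *
      (\<Sum>\<beta>\<in>words n b. S_word S \<beta> * star (S_word S \<beta>))"
    by (simp add: sum_word_ranges)
  also have "\<dots> = (\<Sum>\<alpha>\<in>words n a. S_word S \<alpha> * star (S_word S \<alpha>) * x) *
      (\<Sum>\<beta>\<in>words n b. S_word S \<beta> * star (S_word S \<beta>))"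
    by (simp only: sum_distrib_right)
  finally show ?thesis
    by (simp only: sum_product mult.assoc)
qed

lemma word_comb_eqI:
  assumes "\<And>\<alpha> \<beta>. \<alpha> \<in> words n a \<Longrightarrow> \<beta> \<in> words n b \<Longrightarrow>
    star (S_word S \<alpha>) * x * S_word S \<beta> = scaleC (c \<alpha> \<beta>) 1"
  shows "x = word_comb n S a b c"
proof -
  have "x = (\<Sum>\<alpha>\<in>words n a. \<Sum>\<beta>\<in>words n b.
      S_word S \<alpha> * (star (S_word S \<alpha>) * x * S_word S \<beta>) * star (S_word S \<beta>))"
    by (rule word_expansion)
  also have "\<dots> = word_comb n S a b c"
    unfolding word_comb_def
    by (intro sum.cong refl) (simp add: assms scaleC_mult_left scaleC_mult_right)
  finally show ?thesis .
qed

lemma word_comb_mult: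
  "word_comb n S a b c * word_comb n S b e d =
    word_comb n S a e (\<lambda>\<alpha> \<gamma>. \<Sum>\<beta>\<in>words n b. c \<alpha> \<beta> * d \<beta> \<gamma>)"
proof (rule word_comb_eqI)
  fix \<alpha> \<gamma>
  assume w: "\<alpha> \<in> words n a" "\<gamma> \<in> words n e"
  let ?x = "word_comb n S a b c" and ?y = "word_comb n S b e d"
  have "star (S_word S \<alpha>) * (?x * ?y) * S_word S \<gamma> =
      star (S_word S \<alpha>) * ?x * (\<Sum>\<beta>\<in>words n b. S_word S \<beta> * star (S_word S \<beta>)) * (?y * S_word S \<gamma>)"
    by (simp add: sum_word_ranges mult.assoc)
  also have "\<dots> = (\<Sum>\<beta>\<in>words n b.
      (star (S_word S \<alpha>) * ?x * S_word S \<beta>) * (star (S_word S \<beta>) * ?y * S_word S \<gamma>))"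
    by (simp add: sum_distrib_left sum_distrib_right mult.assoc)
  also have "\<dots> = scaleC (\<Sum>\<beta>\<in>words n b. c \<alpha> \<beta> * d \<beta> \<gamma>) 1"
    by (simp add: word_comb_entry w scaleC_sum_left scaleC_mult_left scaleC_scaleC)
  finally show "star (S_word S \<alpha>) * (?x * ?y) * S_word S \<gamma> = \<dots>" .
qed

lemma word_comb_star:
  "star (word_comb n S a b c) = word_comb n S b a (\<lambda>\<beta> \<alpha>. cnj (c \<alpha> \<beta>))"
proof (rule word_comb_eqI)
  fix \<beta> \<alpha>
  assume w: "\<beta> \<in> words n b" "\<alpha> \<in> words n a"
  have "star (S_word S \<beta>) * star (word_comb n S a b c) * S_word S \<alpha> =
      star (star (S_word S \<alpha>) * word_comb n S a b c * S_word S \<beta>)"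
    by (simp add: star_mult star_star mult.assoc)
  then show "star (S_word S \<beta>) * star (word_comb n S a b c) * S_word S \<alpha> = scaleC (cnj (c \<alpha> \<beta>)) 1"
    by (simp add: word_comb_entry w star_scaleC)
qed

lemma word_comb_add:
  "word_comb n S a b c + word_comb n S a b d = word_comb n S a b (\<lambda>\<alpha> \<beta>. c \<alpha> \<beta> + d \<alpha> \<beta>)"
  by (rule word_comb_eqI) (simp add: distrib_left distrib_right word_comb_entry scaleC_add_left)

lemma word_comb_scaleC:
  "scaleC z (word_comb n S a b c) = word_comb n S a b (\<lambda>\<alpha> \<beta>. z * c \<alpha> \<beta>)"
  by (rule word_comb_eqI) (simp add: scaleC_mult_left scaleC_mult_right word_comb_entry scaleC_scaleC)

text \<open>Inserting \<open>\<Sum>m. S m * star (S m) = 1\<close> in the middle lengthens both words by a common last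
  letter, so combinations can be brought to a common right length.\<close>

lemma word_comb_Suc:
  "word_comb n S a b c = word_comb n S (Suc a) (Suc b)
     (\<lambda>\<alpha> \<beta>. if last \<alpha> = last \<beta> then c (butlast \<alpha>) (butlast \<beta>) else 0)"
proof (rule word_comb_eqI)
  fix \<alpha> \<beta>
  assume "\<alpha> \<in> words n (Suc a)" "\<beta> \<in> words n (Suc b)"
  then obtain \<gamma> l \<delta> m where eq: "\<alpha> = \<gamma> @ [l]" "\<beta> = \<delta> @ [m]"
    and w: "l \<in> {1..n}" "m \<in> {1..n}" "\<gamma> \<in> words n a" "\<delta> \<in> words n b"
    by (elim words_SucE_snoc)
  have "star (S_word S \<alpha>) * word_comb n S a b c * S_word S \<beta> =
      star (S l) * (star (S_word S \<gamma>) * word_comb n S a b c * S_word S \<delta>) * S m"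
    by (simp add: eq S_word_append star_mult mult.assoc)
  also have "\<dots> = scaleC (c \<gamma> \<delta>) (star (S l) * S m)"
    by (simp add: word_comb_entry w scaleC_mult_left scaleC_mult_right)
  also have "star (S l) * S m = (if l = m then 1 else 0)"
    using w isometry isometries_orthogonal by auto
  finally show "star (S_word S \<alpha>) * word_comb n S a b c * S_word S \<beta> =
      scaleC (if last \<alpha> = last \<beta> then c (butlast \<alpha>) (butlast \<beta>) else 0) 1"
    by (simp add: eq split: if_splits)
qed

lemma norm_S_word: "\<alpha> \<in> words n a \<Longrightarrow> norm (S_word S \<alpha>) = 1"
  by (intro norm_isometry S_word_isometry) (auto simp: words_def)

lemma norm_compression_le:
  assumes "\<alpha> \<in> words n a" "\<beta> \<in> words n b"
  shows "norm (star (S_word S \<alpha>) * x * S_word S \<beta>) \<le> norm x"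
proof -
  have "norm (star (S_word S \<alpha>) * x * S_word S \<beta>) \<le> norm (star (S_word S \<alpha>)) * norm x * norm (S_word S \<beta>)"
    by (rule norm_mult3_le)
  then show ?thesis
    by (simp add: norm_S_word[OF assms(1)] norm_S_word[OF assms(2)])
qed

lemma norm_word_comb_ge:
  assumes "\<alpha> \<in> words n a" "\<beta> \<in> words n b"
  shows "cmod (c \<alpha> \<beta>) \<le> norm (word_comb n S a b c)"
  using norm_compression_le[OF assms, of "word_comb n S a b c"]
  by (simp add: word_comb_entry assms norm_scaleC)

lemma norm_word_comb_le:
  "norm (word_comb n S a b c) \<le> (\<Sum>\<alpha>\<in>words n a. \<Sum>\<beta>\<in>words n b. cmod (c \<alpha> \<beta>))"
  unfolding word_comb_def
proof (intro sum_norm_le)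
  fix \<alpha> \<beta>
  assume w: "\<alpha> \<in> words n a" "\<beta> \<in> words n b"
  have "norm (S_word S \<alpha> * star (S_word S \<beta>)) \<le> 1"
    using norm_mult_ineq[of "S_word S \<alpha>" "star (S_word S \<beta>)"] norm_S_word w by simp
  then show "norm (scaleC (c \<alpha> \<beta>) (S_word S \<alpha> * star (S_word S \<beta>))) \<le> cmod (c \<alpha> \<beta>)"
    by (simp add: norm_scaleC mult_left_le)
qed

end

section \<open>Comparison of two Cuntz families\<close>

text \<open>The degree of \<open>S_word S \<alpha> * star (S_word S \<beta>)\<close> is \<open>length \<alpha> - length \<beta>\<close>. Homogeneous
  components are isolated with Cuntz's trick: the isometry \<open>spread D a\<close> inserts the marker
  \<open>1, \<dots>, 1, 2\<close> after the first \<open>a\<close> letters, and as marked words of different lengths are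
  orthogonal, compressing by these isometries keeps one degree and annihilates the others.\<close>

definition marker :: "nat \<Rightarrow> nat list" where
  "marker D = replicate D 1 @ [2]"

context cuntz_family
begin

lemma marker_in_words: "marker D \<in> words n (Suc D)"
  using two_le_n by (auto simp: words_def marker_def)

text \<open>If \<open>\<alpha>\<close> is the shorter word, its marker has the letter \<open>2\<close> at a place where the other word
  still has a letter \<open>1\<close> of its marker.\<close>

lemma marked_words_orthogonal:
  assumes "\<alpha> \<in> words n a" "\<beta> \<in> words n b" "a \<le> D" "b \<le> D" "a \<noteq> b"
  shows "star (S_word S (\<alpha> @ marker D)) * S_word S (\<beta> @ marker D) = 0"
proof -
  have orth: "star (S_word S (\<alpha> @ marker D)) * S_word S (\<beta> @ marker D) = 0"
    if w: "\<alpha> \<in> words n a" "\<beta> \<in> words n b" "a < b" "b \<le> D" for \<alpha> \<beta> a b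
  proof (rule S_word_orthogonal[where p = "a + D"])
    have "(\<alpha> @ marker D) ! (a + D) = 2"
      using w by (simp add: words_def marker_def nth_append)
    moreover have "(\<beta> @ marker D) ! (a + D) = 1"
      using w by (auto simp: words_def marker_def nth_append)
    ultimately show "(\<alpha> @ marker D) ! (a + D) \<noteq> (\<beta> @ marker D) ! (a + D)"
      by simp
  qed (use w two_le_n in \<open>auto simp: words_def marker_def\<close>)
  show ?thesis
  proof (cases "a < b")
    case True
    then show ?thesis
      using orth assms by blast
  next
    case False
    then have "star (S_word S (\<beta> @ marker D)) * S_word S (\<alpha> @ marker D) = 0"
      using orth[of \<beta> b \<alpha> a] assms by simp
    then have "star (star (S_word S (\<beta> @ marker D)) * S_word S (\<alpha> @ marker D)) = 0"
      by simp
    then show ?thesis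
      by (simp only: star_mult star_star)
  qed
qed

definition spread :: "nat \<Rightarrow> nat \<Rightarrow> 'a" where
  "spread D a = (\<Sum>\<alpha>\<in>words n a. S_word S (\<alpha> @ marker D) * star (S_word S \<alpha>))"

lemma spread_star_mult_word:
  assumes "\<alpha> \<in> words n a"
  shows "star (S_word S \<alpha>) * spread D a = S_word S (marker D) * star (S_word S \<alpha>)"
proof -
  have "star (S_word S \<alpha>) * spread D a =
      (\<Sum>\<beta>\<in>words n a. (star (S_word S \<alpha>) * S_word S \<beta>) * (S_word S (marker D) * star (S_word S \<beta>)))"
    by (simp add: spread_def sum_distrib_left S_word_append mult.assoc)
  also have "\<dots> = (\<Sum>\<beta>\<in>words n a. if \<alpha> = \<beta> then S_word S (marker D) * star (S_word S \<beta>) else 0)"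
    by (intro sum.cong refl) (simp add: S_word_star_mult[OF assms])
  finally show ?thesis
    using assms by simp
qed

lemma star_spread_mult_marked:
  assumes w: "\<beta> \<in> words n b" and D: "a \<le> D" "b \<le> D"
  shows "star (spread D a) * S_word S (\<beta> @ marker D) = (if a = b then S_word S \<beta> else 0)"
proof -
  have "star (spread D a) * S_word S (\<beta> @ marker D) =
      (\<Sum>\<alpha>\<in>words n a. S_word S \<alpha> * (star (S_word S (\<alpha> @ marker D)) * S_word S (\<beta> @ marker D)))"
    by (simp add: spread_def star_sum star_mult star_star sum_distrib_right mult.assoc)
  also have "\<dots> = (if a = b then S_word S \<beta> else 0)"
  proof (cases "a = b")
    case True
    have "(\<Sum>\<alpha>\<in>words n a. S_word S \<alpha> * (star (S_word S (\<alpha> @ marker D)) * S_word S (\<beta> @ marker D))) =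
        (\<Sum>\<alpha>\<in>words n a. if \<alpha> = \<beta> then S_word S \<alpha> else 0)"
    proof (intro sum.cong refl)
      fix \<alpha>
      assume "\<alpha> \<in> words n a"
      then show "S_word S \<alpha> * (star (S_word S (\<alpha> @ marker D)) * S_word S (\<beta> @ marker D)) =
          (if \<alpha> = \<beta> then S_word S \<alpha> else 0)"
        using S_word_star_mult[OF append_in_words[OF _ marker_in_words, of \<alpha> a D]
            append_in_words[OF _ marker_in_words, of \<beta> a D]] w True
        by simp
    qed
    then show ?thesis
      using True w by simp
  next
    case False
    then show ?thesis
      using marked_words_orthogonal[OF _ w D] by simp
  qed
  finally show ?thesis .
qed

lemma norm_spread: "norm (spread D a) = 1"
proof (rule norm_isometry)
  have "star (spread D a) * spread D a =
      (\<Sum>\<alpha>\<in>words n a. S_word S \<alpha> * star (S_word S (\<alpha> @ marker D)) * spread D a)"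
    by (subst spread_def) (simp add: star_sum star_mult star_star sum_distrib_right)
  also have "\<dots> = (\<Sum>\<alpha>\<in>words n a. S_word S \<alpha> * star (S_word S \<alpha>))"
  proof (intro sum.cong refl)
    fix \<alpha>
    assume w: "\<alpha> \<in> words n a"
    have "star (S_word S (marker D)) * S_word S (marker D) = 1"
      using S_word_star_mult[OF marker_in_words marker_in_words] by simp
    then have "star (S_word S (\<alpha> @ marker D)) * spread D a = star (S_word S \<alpha>)"
      by (simp add: S_word_append star_mult mult.assoc spread_star_mult_word[OF w])
        (simp flip: mult.assoc)
    then show "S_word S \<alpha> * star (S_word S (\<alpha> @ marker D)) * spread D a = S_word S \<alpha> * star (S_word S \<alpha>)"
      by (simp add: mult.assoc)
  qed
  finally show "star (spread D a) * spread D a = 1"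
    by (simp add: sum_word_ranges)
qed

lemma spread_compression:
  assumes D: "a \<le> D" "a' \<le> D"
  shows "star (spread D a) * word_comb n S a' b c * spread D b = (if a = a' then word_comb n S a' b c else 0)"
proof -
  have "star (spread D a) * word_comb n S a' b c * spread D b =
    (\<Sum>\<alpha>\<in>words n a'. \<Sum>\<beta>\<in>words n b. scaleC (c \<alpha> \<beta>)
      (star (spread D a) * S_word S \<alpha> * (star (S_word S \<beta>) * spread D b)))"
    by (simp add: word_comb_def sum_distrib_left sum_distrib_right scaleC_mult_left
        scaleC_mult_right mult.assoc)
  also have "\<dots> = (\<Sum>\<alpha>\<in>words n a'. \<Sum>\<beta>\<in>words n b. scaleC (c \<alpha> \<beta>)
      (star (spread D a) * S_word S (\<alpha> @ marker D) * star (S_word S \<beta>)))"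
    by (intro sum.cong refl) (simp add: spread_star_mult_word S_word_append mult.assoc)
  also have "\<dots> = (if a = a' then word_comb n S a' b c else 0)"
    by (simp add: star_spread_mult_marked D word_comb_def)
  finally show ?thesis .
qed

text \<open>Compression by the spreading isometries is contractive and annihilates every summand whose
  degree differs from that of the chosen one.\<close>

lemma norm_component_le:
  assumes "finite A" "inj_on len A" "a \<in> A"
  shows "norm (word_comb n S (len a) b (c a)) \<le> norm (\<Sum>a\<in>A. word_comb n S (len a) b (c a))"
proof -
  define D where "D = Max (len ` A)"
  have D: "len a' \<le> D" if "a' \<in> A" for a'
    using that assms by (simp add: D_def)
  let ?x = "\<Sum>a\<in>A. word_comb n S (len a) b (c a)"
  have "star (spread D (len a)) * ?x * spread D b =
      (\<Sum>a'\<in>A. star (spread D (len a)) * word_comb n S (len a') b (c a') * spread D b)"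
    by (simp add: sum_distrib_left sum_distrib_right)
  also have "\<dots> = (\<Sum>a'\<in>A. if a = a' then word_comb n S (len a') b (c a') else 0)"
    using assms D by (intro sum.cong refl) (auto simp: spread_compression inj_on_eq_iff)
  also have "\<dots> = word_comb n S (len a) b (c a)"
    using assms by simp
  finally have "norm (word_comb n S (len a) b (c a)) \<le>
      norm (star (spread D (len a))) * norm ?x * norm (spread D b)"
    by (metis norm_mult3_le)
  then show ?thesis
    by (simp add: norm_spread)
qed

lemma one_eq_word_comb: "1 = word_comb n S a a (\<lambda>\<alpha> \<beta>. if \<alpha> = \<beta> then 1 else 0)"
  by (rule word_comb_eqI) (simp add: S_word_star_mult)

lemma isometry_eq_word_comb:
  assumes "i \<in> {1..n}"
  shows "S i = word_comb n S 1 0 (\<lambda>\<alpha> \<beta>. if \<alpha> = [i] then 1 else 0)"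
proof (rule word_comb_eqI)
  fix \<alpha> \<beta>
  assume w: "\<alpha> \<in> words n 1" "\<beta> \<in> words n 0"
  have i: "[i] \<in> words n 1"
    using assms by (simp add: words_def)
  show "star (S_word S \<alpha>) * S i * S_word S \<beta> = scaleC (if \<alpha> = [i] then 1 else 0) 1"
    using S_word_star_mult[OF w(1) i] w(2) by simp
qed

end

subsection \<open>Equality of norms\<close>

text \<open>In a C*-algebra the norm of \<open>x\<close> is recovered from the growth of the powers of \<open>star x * x\<close>;
  hence a comparison of norms up to a factor of subexponential growth is an honest comparison.\<close>

lemma norm_le_of_power_growth:
  fixes x :: "'a::cstar_algebra" and y :: "'b::cstar_algebra"
  assumes bound: "\<And>j. norm ((star y * y) ^ (2 ^ j)) \<le> C * 2 ^ j * norm ((star x * x) ^ (2 ^ j))"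
  shows "norm y \<le> norm x"
proof (rule ccontr)
  assume "\<not> norm y \<le> norm x"
  then have less: "norm x < norm y"
    by simp
  define u where "u = (norm x)\<^sup>2"
  define v where "v = (norm y)\<^sup>2"
  have uv: "0 \<le> u" "u < v"
    using less by (auto simp: u_def v_def power_strict_mono)
  then have v: "0 < v"
    by simp
  have pow: "norm ((star z * z) ^ (2 ^ j)) = ((norm z)\<^sup>2) ^ (2 ^ j)" for z :: "'c::cstar_algebra" and j
    using norm_selfadjoint_power[of "star z * z" j] by (simp add: star_mult star_star cstar_identity)
  define q where "q = u / v"
  have "1 \<le> C * (real (2 ^ j) * q ^ (2 ^ j))" for j
  proof -
    have "v ^ (2 ^ j) \<le> C * 2 ^ j * u ^ (2 ^ j)"
      using bound[of j] by (simp only: pow u_def v_def)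
    then show ?thesis
      using v by (simp add: q_def power_divide field_simps)
  qed
  moreover have "(\<lambda>j. C * (real (2 ^ j) * q ^ (2 ^ j))) \<longlonglongrightarrow> C * 0"
  proof (rule tendsto_mult[OF tendsto_const])
    have "norm q < 1"
      using uv by (simp add: q_def)
    then have "(\<lambda>m. real m * q ^ m) \<longlonglongrightarrow> 0"
      by (rule powser_times_n_limit_0)
    moreover have "strict_mono (\<lambda>j. 2 ^ j :: nat)"
      by (simp add: strict_mono_def)
    ultimately show "(\<lambda>j. real (2 ^ j) * q ^ (2 ^ j)) \<longlonglongrightarrow> 0"
      using LIMSEQ_subseq_LIMSEQ[of "\<lambda>m. real m * q ^ m" 0 "\<lambda>j. 2 ^ j"] by (simp add: o_def)
  qed
  ultimately have "1 \<le> C * 0"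
    by (intro LIMSEQ_le_const) auto
  then show False
    by simp
qed

locale cuntz_pair = S: cuntz_family n S + T: cuntz_family n T
  for n :: nat and S :: "nat \<Rightarrow> 'a::cstar_algebra" and T :: "nat \<Rightarrow> 'b::cstar_algebra"
begin

definition homog_pair :: "nat \<Rightarrow> nat \<Rightarrow> 'a \<Rightarrow> 'b \<Rightarrow> bool" where
  "homog_pair a b x y \<longleftrightarrow> (\<exists>c. x = word_comb n S a b c \<and> y = word_comb n T a b c)"

lemma homog_pair_word_comb: "homog_pair a b (word_comb n S a b c) (word_comb n T a b c)"
  by (auto simp: homog_pair_def)

lemma homog_pair_mult: "homog_pair a b x y \<Longrightarrow> homog_pair b e x' y' \<Longrightarrow> homog_pair a e (x * x') (y * y')"
  unfolding homog_pair_def using S.word_comb_mult T.word_comb_mult by blast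

lemma homog_pair_star: "homog_pair a b x y \<Longrightarrow> homog_pair b a (star x) (star y)"
  unfolding homog_pair_def using S.word_comb_star T.word_comb_star by blast

lemma homog_pair_add: "homog_pair a b x y \<Longrightarrow> homog_pair a b x' y' \<Longrightarrow> homog_pair a b (x + x') (y + y')"
  unfolding homog_pair_def using S.word_comb_add T.word_comb_add by blast

lemma homog_pair_scaleC: "homog_pair a b x y \<Longrightarrow> homog_pair a b (scaleC z x) (scaleC z y)"
  unfolding homog_pair_def using S.word_comb_scaleC T.word_comb_scaleC by blast

lemma homog_pair_zero: "homog_pair a b 0 0"
  using homog_pair_word_comb[of a b "\<lambda>_ _. 0"] by (simp add: word_comb_def)

lemma homog_pair_sum:
  "(\<And>i. i \<in> I \<Longrightarrow> homog_pair a b (f i) (g i)) \<Longrightarrow> homog_pair a b (\<Sum>i\<in>I. f i) (\<Sum>i\<in>I. g i)"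
  by (induction I rule: infinite_finite_induct) (auto intro: homog_pair_zero homog_pair_add)

lemma homog_pair_one: "homog_pair a a 1 1"
  unfolding homog_pair_def using S.one_eq_word_comb[of a] T.one_eq_word_comb[of a] by blast

lemma homog_pair_isometry: "i \<in> {1..n} \<Longrightarrow> homog_pair 1 0 (S i) (T i)"
  unfolding homog_pair_def using S.isometry_eq_word_comb[of i] T.isometry_eq_word_comb[of i] by blast

lemma homog_pair_shift: "homog_pair a b x y \<Longrightarrow> homog_pair (a + t) (b + t) x y"
proof (induction t)
  case (Suc t)
  then obtain c where c: "x = word_comb n S (a + t) (b + t) c" "y = word_comb n T (a + t) (b + t) c"
    unfolding homog_pair_def by blast
  show ?case
    unfolding homog_pair_def add_Suc_right
    using trans[OF c(1) S.word_comb_Suc] trans[OF c(2) T.word_comb_Suc] by blast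
qed simp

lemma homog_pair_shift_to: "homog_pair a b x y \<Longrightarrow> a' = a + t \<Longrightarrow> b' = b + t \<Longrightarrow> homog_pair a' b' x y"
  by (simp add: homog_pair_shift)

lemma homog_pair_power: "homog_pair a a x y \<Longrightarrow> homog_pair a a (x ^ m) (y ^ m)"
  by (induction m) (auto intro: homog_pair_mult homog_pair_one)

text \<open>The powers of \<open>star x * x\<close> all lie in the finite-dimensional algebra of combinations with both
  lengths equal to \<open>b\<close>, where both norms are equivalent to the size of the coefficients; the constant
  disappears by taking powers.\<close>

lemma norm_homog_pair_le:
  assumes "homog_pair a b x y"
  shows "norm y \<le> norm x"
proof -
  have "homog_pair b b (star x * x) (star y * y)"
    by (intro homog_pair_mult[of b a] homog_pair_star assms)
  then have pow: "homog_pair b b ((star x * x) ^ m) ((star y * y) ^ m)" for m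
    by (rule homog_pair_power)
  define N where "N = real (card (words n b)) * real (card (words n b))"
  \<comment> \<open>\<open>y'\<close> is bounded by the sum of its coefficients, and each of them is bounded by \<open>norm x'\<close>.\<close>
  have coarse: "norm y' \<le> N * norm x'" if h: "homog_pair b b x' y'" for x' y'
  proof -
    obtain c where c: "x' = word_comb n S b b c" "y' = word_comb n T b b c"
      using h unfolding homog_pair_def by blast
    have "norm y' \<le> (\<Sum>\<alpha>\<in>words n b. \<Sum>\<beta>\<in>words n b. cmod (c \<alpha> \<beta>))"
      unfolding c by (rule T.norm_word_comb_le)
    also have "\<dots> \<le> (\<Sum>\<alpha>\<in>words n b. \<Sum>\<beta>\<in>words n b. norm x')"
      unfolding c by (intro sum_mono S.norm_word_comb_ge)
    finally show ?thesis
      by (simp add: N_def)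
  qed
  show ?thesis
  proof (rule norm_le_of_power_growth)
    fix j :: nat
    have "norm ((star y * y) ^ (2 ^ j)) \<le> N * 1 * norm ((star x * x) ^ (2 ^ j))"
      using coarse[OF pow] by simp
    also have "\<dots> \<le> N * 2 ^ j * norm ((star x * x) ^ (2 ^ j))"
      by (intro mult_right_mono mult_left_mono) (auto simp: N_def)
    finally show "norm ((star y * y) ^ (2 ^ j)) \<le> N * 2 ^ j * norm ((star x * x) ^ (2 ^ j))" .
  qed
qed

text \<open>Polynomials in the generators are organised in levels: level \<open>K\<close> has the components of
  degree \<open>-K, \<dots>, K\<close>, written with the common right length \<open>K\<close>. Levels add under multiplication,
  so the number of components of an \<open>m\<close>-th power grows linearly in \<open>m\<close>.\<close>

definition level_pair :: "nat \<Rightarrow> 'a \<Rightarrow> 'b \<Rightarrow> bool" where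
  "level_pair K x y \<longleftrightarrow>
    (\<exists>u v. x = (\<Sum>a\<le>2 * K. u a) \<and> y = (\<Sum>a\<le>2 * K. v a) \<and> (\<forall>a\<le>2 * K. homog_pair a K (u a) (v a)))"

lemma level_pair_zero: "level_pair K 0 0"
  unfolding level_pair_def
  by (rule exI[of _ "\<lambda>_. 0"], rule exI[of _ "\<lambda>_. 0"]) (simp add: homog_pair_zero)

lemma level_pair_add:
  assumes "level_pair K x y" "level_pair K x' y'"
  shows "level_pair K (x + x') (y + y')"
proof -
  obtain u v u' v' where
    uv: "x = (\<Sum>a\<le>2 * K. u a)" "y = (\<Sum>a\<le>2 * K. v a)" "\<forall>a\<le>2 * K. homog_pair a K (u a) (v a)" and
    uv': "x' = (\<Sum>a\<le>2 * K. u' a)" "y' = (\<Sum>a\<le>2 * K. v' a)" "\<forall>a\<le>2 * K. homog_pair a K (u' a) (v' a)"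
    using assms unfolding level_pair_def by blast
  show ?thesis
    unfolding level_pair_def
    by (rule exI[of _ "\<lambda>a. u a + u' a"], rule exI[of _ "\<lambda>a. v a + v' a"])
      (use uv uv' in \<open>simp add: sum.distrib homog_pair_add\<close>)
qed

lemma level_pair_sum:
  "(\<And>i. i \<in> I \<Longrightarrow> level_pair K (f i) (g i)) \<Longrightarrow> level_pair K (\<Sum>i\<in>I. f i) (\<Sum>i\<in>I. g i)"
  by (induction I rule: infinite_finite_induct) (auto intro: level_pair_zero level_pair_add)

lemma level_pair_homog:
  assumes "homog_pair a K x y" "a \<le> 2 * K"
  shows "level_pair K x y"
  unfolding level_pair_def
  by (rule exI[of _ "\<lambda>a'. if a' = a then x else 0"], rule exI[of _ "\<lambda>a'. if a' = a then y else 0"])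
    (use assms in \<open>auto simp: homog_pair_zero\<close>)

lemma level_pairE:
  assumes "level_pair K x y"
  obtains u v where "x = (\<Sum>a\<le>2 * K. u a)" "y = (\<Sum>a\<le>2 * K. v a)"
    "\<And>a. a \<le> 2 * K \<Longrightarrow> homog_pair a K (u a) (v a)"
  using assms unfolding level_pair_def by blast

lemma level_pair_scaleC:
  assumes "level_pair K x y"
  shows "level_pair K (scaleC z x) (scaleC z y)"
  using assms
proof (rule level_pairE)
  fix u v
  assume uv: "x = (\<Sum>a\<le>2 * K. u a)" "y = (\<Sum>a\<le>2 * K. v a)"
    "\<And>a. a \<le> 2 * K \<Longrightarrow> homog_pair a K (u a) (v a)"
  show ?thesis
    unfolding uv(1,2) scaleC_sum_right
    by (intro level_pair_sum level_pair_homog[OF homog_pair_scaleC[OF uv(3)]]) auto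
qed

lemma level_pair_mult:
  assumes "level_pair K x y" "level_pair L x' y'"
  shows "level_pair (K + L) (x * x') (y * y')"
proof -
  obtain u v where uv: "x = (\<Sum>a\<le>2 * K. u a)" "y = (\<Sum>a\<le>2 * K. v a)"
    "\<And>a. a \<le> 2 * K \<Longrightarrow> homog_pair a K (u a) (v a)"
    using assms(1) by (rule level_pairE) blast
  obtain u' v' where uv': "x' = (\<Sum>a\<le>2 * L. u' a)" "y' = (\<Sum>a\<le>2 * L. v' a)"
    "\<And>a. a \<le> 2 * L \<Longrightarrow> homog_pair a L (u' a) (v' a)"
    using assms(2) by (rule level_pairE) blast
  show ?thesis
    unfolding uv(1,2) uv'(1,2) sum_product
  proof (intro level_pair_sum)
    fix a b
    assume "a \<in> {..2 * K}" "b \<in> {..2 * L}"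
    then have ab: "a \<le> 2 * K" "b \<le> 2 * L"
      by auto
    have "homog_pair (a + b) (K + b) (u a) (v a)"
      by (rule homog_pair_shift[OF uv(3)[OF ab(1)]])
    moreover have "homog_pair (K + b) (K + L) (u' b) (v' b)"
      by (rule homog_pair_shift_to[OF uv'(3)[OF ab(2)]]) simp_all
    ultimately have "homog_pair (a + b) (K + L) (u a * u' b) (v a * v' b)"
      by (rule homog_pair_mult)
    then show "level_pair (K + L) (u a * u' b) (v a * v' b)"
      by (rule level_pair_homog) (use ab in simp)
  qed
qed

lemma level_pair_star:
  assumes "level_pair K x y"
  shows "level_pair (2 * K) (star x) (star y)"
  using assms
proof (rule level_pairE)
  fix u v
  assume uv: "x = (\<Sum>a\<le>2 * K. u a)" "y = (\<Sum>a\<le>2 * K. v a)"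
    "\<And>a. a \<le> 2 * K \<Longrightarrow> homog_pair a K (u a) (v a)"
  show ?thesis
    unfolding uv(1,2) star_sum
  proof (intro level_pair_sum)
    fix a
    assume "a \<in> {..2 * K}"
    then have a: "a \<le> 2 * K"
      by simp
    have "homog_pair (K + (2 * K - a)) (2 * K) (star (u a)) (star (v a))"
      by (rule homog_pair_shift_to[OF homog_pair_star[OF uv(3)[OF a]], where t = "2 * K - a"])
        (use a in simp_all)
    then show "level_pair (2 * K) (star (u a)) (star (v a))"
      by (rule level_pair_homog) simp
  qed
qed

lemma level_pair_mono:
  assumes "level_pair K x y" "K \<le> L"
  shows "level_pair L x y"
  using assms(1)
proof (rule level_pairE)
  fix u v
  assume uv: "x = (\<Sum>a\<le>2 * K. u a)" "y = (\<Sum>a\<le>2 * K. v a)"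
    "\<And>a. a \<le> 2 * K \<Longrightarrow> homog_pair a K (u a) (v a)"
  show ?thesis
    unfolding uv(1,2)
  proof (intro level_pair_sum)
    fix a
    assume "a \<in> {..2 * K}"
    then have a: "a \<le> 2 * K"
      by simp
    have "homog_pair (a + (L - K)) L (u a) (v a)"
      by (rule homog_pair_shift_to[OF uv(3)[OF a], where t = "L - K"]) (use assms(2) in simp_all)
    then show "level_pair L (u a) (v a)"
      by (rule level_pair_homog) (use a assms(2) in simp)
  qed
qed

lemma level_pair_one: "level_pair K 1 1"
  by (rule level_pair_homog[OF homog_pair_one]) simp

lemma level_pair_isometry: "i \<in> {1..n} \<Longrightarrow> level_pair 1 (S i) (T i)"
  by (rule level_pair_homog[OF homog_pair_shift_to[OF homog_pair_isometry, of i _ 1]]) auto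

lemma level_pair_power: "level_pair K x y \<Longrightarrow> level_pair (m * K) (x ^ m) (y ^ m)"
  by (induction m) (auto intro: level_pair_mult level_pair_one)

text \<open>Each component of \<open>y\<close> has the norm of the corresponding component of \<open>x\<close>, and the latter is
  at most the norm of \<open>x\<close>.\<close>

lemma norm_level_pair_coarse:
  assumes "level_pair K x y"
  shows "norm y \<le> (2 * real K + 1) * norm x"
proof -
  obtain u v where uv: "x = (\<Sum>a\<le>2 * K. u a)" "y = (\<Sum>a\<le>2 * K. v a)"
    "\<And>a. a \<le> 2 * K \<Longrightarrow> homog_pair a K (u a) (v a)"
    using assms by (rule level_pairE) blast
  have "\<forall>a. \<exists>c. a \<le> 2 * K \<longrightarrow> u a = word_comb n S a K c"
    using uv(3) unfolding homog_pair_def by blast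
  then obtain c where c: "\<And>a. a \<le> 2 * K \<Longrightarrow> u a = word_comb n S a K (c a)"
    by metis
  have x: "x = (\<Sum>a\<le>2 * K. word_comb n S a K (c a))"
    unfolding uv by (intro sum.cong refl) (simp add: c)
  have "norm y \<le> (\<Sum>a\<le>2 * K. norm x)"
    unfolding uv(2)
  proof (rule sum_norm_le)
    fix a
    assume a: "a \<in> {..2 * K}"
    have "norm (v a) \<le> norm (u a)"
      using a by (intro norm_homog_pair_le[OF uv(3)]) simp
    also have "\<dots> \<le> norm x"
      using S.norm_component_le[of "{..2 * K}" "\<lambda>a. a" a K c] a unfolding x by (simp add: c)
    finally show "norm (v a) \<le> norm x" .
  qed
  then show ?thesis
    by (simp add: add.commute)
qed

lemma norm_level_pair_le:
  assumes "level_pair K x y"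
  shows "norm y \<le> norm x"
proof (rule norm_le_of_power_growth)
  fix j :: nat
  \<comment> \<open>\<open>star x\<close> has level \<open>2 * K\<close>, since its right lengths have to be raised to a common value.\<close>
  define M where "M = 2 * K + K"
  have "level_pair M (star x * x) (star y * y)"
    unfolding M_def by (intro level_pair_mult level_pair_star assms)
  then have "level_pair (2 ^ j * M) ((star x * x) ^ (2 ^ j)) ((star y * y) ^ (2 ^ j))"
    by (rule level_pair_power)
  then have "norm ((star y * y) ^ (2 ^ j)) \<le> (2 * real (2 ^ j * M) + 1) * norm ((star x * x) ^ (2 ^ j))"
    by (rule norm_level_pair_coarse)
  also have "\<dots> \<le> ((2 * real M + 1) * 2 ^ j) * norm ((star x * x) ^ (2 ^ j))"
    by (intro mult_right_mono) (auto simp: algebra_simps)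
  finally show "norm ((star y * y) ^ (2 ^ j)) \<le> (2 * real M + 1) * 2 ^ j * norm ((star x * x) ^ (2 ^ j))" .
qed

end

lemma cuntz_pair_swap: "cuntz_pair n S T \<Longrightarrow> cuntz_pair n T S"
  by (auto simp: cuntz_pair_def)

context cuntz_pair
begin

lemma norm_level_pair_eq:
  assumes "level_pair K x y"
  shows "norm y = norm x"
proof (rule antisym)
  interpret swap: cuntz_pair n T S
    by (rule cuntz_pair_swap) unfold_locales
  have "swap.homog_pair a b y' x'" if "homog_pair a b x' y'" for a b x' y'
    using that unfolding homog_pair_def swap.homog_pair_def by blast
  then have "swap.level_pair K y x"
    using assms unfolding level_pair_def swap.level_pair_def by blast
  then show "norm x \<le> norm y"
    by (rule swap.norm_level_pair_le)
qed (rule norm_level_pair_le[OF assms])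

end

section \<open>The universal property of the Cuntz algebra\<close>

context cuntz_pair
begin

text \<open>The graph of the homomorphism \<open>S i \<mapsto> T i\<close>: the closure of its graph on polynomials. As
  related elements have equal norms, it is an isometric function on a closed domain.\<close>

definition graph :: "('a \<times> 'b) set" where
  "graph = closure {(x, y). \<exists>K. level_pair K x y}"

lemma graphE:
  assumes "(x, y) \<in> graph"
  obtains X Y K where "\<And>m. level_pair (K m) (X m) (Y m)" "X \<longlonglongrightarrow> x" "Y \<longlonglongrightarrow> y"
proof -
  obtain p where p: "\<forall>m. p m \<in> {(x, y). \<exists>K. level_pair K x y}" "p \<longlonglongrightarrow> (x, y)"
    using assms unfolding graph_def closure_sequential by blast
  have "\<forall>m. \<exists>K. level_pair K (fst (p m)) (snd (p m))"
    using p(1) by (auto simp: case_prod_unfold)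
  then obtain K where "\<And>m. level_pair (K m) (fst (p m)) (snd (p m))"
    by metis
  then show ?thesis
    using that[of K "\<lambda>m. fst (p m)" "\<lambda>m. snd (p m)"] tendsto_fst[OF p(2)] tendsto_snd[OF p(2)] by simp
qed

lemma graphI:
  assumes "\<And>m. level_pair (K m) (X m) (Y m)" "X \<longlonglongrightarrow> x" "Y \<longlonglongrightarrow> y"
  shows "(x, y) \<in> graph"
  unfolding graph_def closure_sequential
  by (rule exI[of _ "\<lambda>m. (X m, Y m)"]) (use assms in \<open>auto intro!: tendsto_Pair\<close>)

lemma graph_level_pair: "level_pair K x y \<Longrightarrow> (x, y) \<in> graph"
  by (rule graphI[of "\<lambda>_. K" "\<lambda>_. x" "\<lambda>_. y"]) auto

lemma graph_add:
  assumes "(x, y) \<in> graph" "(x', y') \<in> graph"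
  shows "(x + x', y + y') \<in> graph"
proof -
  obtain X Y K where 1: "\<And>m. level_pair (K m) (X m) (Y m)" "X \<longlonglongrightarrow> x" "Y \<longlonglongrightarrow> y"
    using assms(1) by (rule graphE) blast
  obtain X' Y' K' where 2: "\<And>m. level_pair (K' m) (X' m) (Y' m)" "X' \<longlonglongrightarrow> x'" "Y' \<longlonglongrightarrow> y'"
    using assms(2) by (rule graphE) blast
  show ?thesis
  proof (rule graphI[where X = "\<lambda>m. X m + X' m" and Y = "\<lambda>m. Y m + Y' m"])
    show "level_pair (max (K m) (K' m)) (X m + X' m) (Y m + Y' m)" for m
      by (intro level_pair_add level_pair_mono[OF 1(1)] level_pair_mono[OF 2(1)]) auto
  qed (intro tendsto_add 1 2)+
qed

lemma graph_mult:
  assumes "(x, y) \<in> graph" "(x', y') \<in> graph"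
  shows "(x * x', y * y') \<in> graph"
proof -
  obtain X Y K where 1: "\<And>m. level_pair (K m) (X m) (Y m)" "X \<longlonglongrightarrow> x" "Y \<longlonglongrightarrow> y"
    using assms(1) by (rule graphE) blast
  obtain X' Y' K' where 2: "\<And>m. level_pair (K' m) (X' m) (Y' m)" "X' \<longlonglongrightarrow> x'" "Y' \<longlonglongrightarrow> y'"
    using assms(2) by (rule graphE) blast
  show ?thesis
    by (rule graphI[where K = "\<lambda>m. K m + K' m" and X = "\<lambda>m. X m * X' m" and Y = "\<lambda>m. Y m * Y' m"])
      (intro level_pair_mult tendsto_mult 1 2)+
qed

lemma graph_scaleC:
  assumes "(x, y) \<in> graph"
  shows "(scaleC c x, scaleC c y) \<in> graph"
proof -
  obtain X Y K where 1: "\<And>m. level_pair (K m) (X m) (Y m)" "X \<longlonglongrightarrow> x" "Y \<longlonglongrightarrow> y"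
    using assms by (rule graphE) blast
  show ?thesis
    by (rule graphI[where K = K and X = "\<lambda>m. scaleC c (X m)" and Y = "\<lambda>m. scaleC c (Y m)"])
      (intro level_pair_scaleC bounded_linear.tendsto[OF bounded_linear_scaleC] 1)+
qed

lemma graph_star:
  assumes "(x, y) \<in> graph"
  shows "(star x, star y) \<in> graph"
proof -
  obtain X Y K where 1: "\<And>m. level_pair (K m) (X m) (Y m)" "X \<longlonglongrightarrow> x" "Y \<longlonglongrightarrow> y"
    using assms by (rule graphE) blast
  show ?thesis
    by (rule graphI[where K = "\<lambda>m. 2 * K m" and X = "\<lambda>m. star (X m)" and Y = "\<lambda>m. star (Y m)"])
      (intro level_pair_star bounded_linear.tendsto[OF bounded_linear_star] 1)+
qed

lemma graph_norm:
  assumes "(x, y) \<in> graph"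
  shows "norm y = norm x"
  using assms
proof (rule graphE)
  fix X Y K
  assume 1: "\<And>m. level_pair (K m) (X m) (Y m)" "X \<longlonglongrightarrow> x" "Y \<longlonglongrightarrow> y"
  have "(\<lambda>m. norm (X m)) \<longlonglongrightarrow> norm x" "(\<lambda>m. norm (Y m)) \<longlonglongrightarrow> norm y"
    by (intro tendsto_norm 1)+
  then show "norm y = norm x"
    by (simp add: norm_level_pair_eq[OF 1(1)] LIMSEQ_unique)
qed

lemma graph_diff:
  assumes "(x, y) \<in> graph" "(x', y') \<in> graph"
  shows "(x - x', y - y') \<in> graph"
  using graph_add[OF assms(1) graph_scaleC[OF assms(2), of "-1"]]
  by (simp add: scaleC_minus_left)

lemma graph_unique:
  assumes "(x, y) \<in> graph" "(x, y') \<in> graph"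
  shows "y = y'"
  using graph_norm[OF graph_diff[OF assms]] by simp

text \<open>The domain is closed because the graph is that of an isometry into a complete space.\<close>

lemma cstar_subalgebra_graph_domain: "cstar_subalgebra (Domain graph)"
  unfolding cstar_subalgebra_def
proof (intro conjI ballI allI)
  show "closed (Domain graph)"
    unfolding closed_sequential_limits
  proof (intro allI impI, elim conjE)
    fix X x
    assume X: "\<forall>m. X m \<in> Domain graph" "X \<longlonglongrightarrow> x"
    then obtain Y where Y: "\<And>m. (X m, Y m) \<in> graph"
    proof -
      have "\<forall>m. \<exists>y. (X m, y) \<in> graph"
        using X(1) by blast
      then show ?thesis
        using that by metis
    qed
    have "dist (Y m) (Y m') = dist (X m) (X m')" for m m'
      using graph_norm[OF graph_diff[OF Y[of m] Y[of m']]] by (simp add: dist_norm)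
    then have "Cauchy Y"
      using LIMSEQ_imp_Cauchy[OF X(2)] by (simp add: Cauchy_def)
    then obtain y where "Y \<longlonglongrightarrow> y"
      using Cauchy_convergent_iff convergent_def by blast
    then have "(\<lambda>m. (X m, Y m)) \<longlonglongrightarrow> (x, y)"
      using X(2) by (intro tendsto_Pair)
    moreover have "closed graph"
      by (simp add: graph_def)
    ultimately have "(x, y) \<in> graph"
      using closed_sequentially[of graph "\<lambda>m. (X m, Y m)" "(x, y)"] Y by simp
    then show "x \<in> Domain graph"
      by blast
  qed
  show "0 \<in> Domain graph"
    using graph_level_pair[OF level_pair_zero] by blast
qed (auto intro: graph_add graph_mult graph_scaleC graph_star)

end

lemma cuntz_algebra_imp_family: "2 \<le> n \<Longrightarrow> cuntz_algebra n S \<Longrightarrow> cuntz_family n S"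
  by (auto simp: cuntz_algebra_def cuntz_family_def)

lemma cuntz_algebra_subalgebra_eq_UNIV:
  assumes "cuntz_algebra n S" "cstar_subalgebra B" "S ` {1..n} \<subseteq> B"
  shows "B = UNIV"
  using assms hull_minimal[of "S ` {1..n}" B cstar_subalgebra] by (auto simp: cuntz_algebra_def)

text \<open>The approximation clause says that \<open>\<phi>\<close> acts on polynomials by substituting \<open>T\<close> for \<open>S\<close>.\<close>

lemma cuntz_algebra_universal:
  fixes S T :: "nat \<Rightarrow> 'a::cstar_algebra"
  assumes "2 \<le> n" "cuntz_algebra n S" "cuntz_family n T"
  obtains \<phi> where "unital_star_endomorphism \<phi>" "\<And>x. norm (\<phi> x) = norm x"
    "\<And>i. i \<in> {1..n} \<Longrightarrow> \<phi> (S i) = T i"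
    "\<And>x \<epsilon>. \<epsilon> > 0 \<Longrightarrow> \<exists>K x' y'. cuntz_pair.level_pair n S T K x' y' \<and> norm (\<phi> x - y') < \<epsilon>"
proof -
  interpret cuntz_pair n S T
    unfolding cuntz_pair_def using assms cuntz_algebra_imp_family by blast
  have gen: "(S i, T i) \<in> graph" if "i \<in> {1..n}" for i
    using graph_level_pair[OF level_pair_isometry[OF that]] .
  have dom: "Domain graph = UNIV"
    by (rule cuntz_algebra_subalgebra_eq_UNIV[OF assms(2) cstar_subalgebra_graph_domain])
      (use gen in blast)
  define \<phi> where "\<phi> x = (SOME y. (x, y) \<in> graph)" for x
  have \<phi>: "(x, \<phi> x) \<in> graph" for x
    unfolding \<phi>_def by (rule someI_ex) (use dom in blast)
  have eq: "\<phi> x = y" if "(x, y) \<in> graph" for x y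
    using graph_unique[OF \<phi> that] .
  show ?thesis
  proof (rule that)
    show "unital_star_endomorphism \<phi>"
      unfolding unital_star_endomorphism_def
      by (intro conjI allI eq graph_add graph_mult graph_scaleC graph_star \<phi>
          graph_level_pair[OF level_pair_one])
    show "norm (\<phi> x) = norm x" for x
      by (rule graph_norm[OF \<phi>])
    show "\<phi> (S i) = T i" if "i \<in> {1..n}" for i
      by (rule eq[OF gen[OF that]])
    show "\<exists>K x' y'. level_pair K x' y' \<and> norm (\<phi> x - y') < \<epsilon>" if "\<epsilon> > 0" for x \<epsilon>
      using \<phi>[of x]
    proof (rule graphE)
      fix X Y K
      assume 1: "\<And>m. level_pair (K m) (X m) (Y m)" "Y \<longlonglongrightarrow> \<phi> x"
      obtain m where "norm (Y m - \<phi> x) < \<epsilon>"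
        using LIMSEQ_D[OF 1(2) \<open>\<epsilon> > 0\<close>] by blast
      then have "norm (\<phi> x - Y m) < \<epsilon>"
        by (simp add: norm_minus_commute)
      then show ?thesis
        using 1(1) by blast
    qed
  qed
qed

text \<open>Uniqueness holds among all endomorphisms because they are automatically continuous.\<close>

lemma unital_star_endomorphism_unique:
  assumes "cuntz_algebra n S" "unital_star_endomorphism \<phi>" "unital_star_endomorphism \<psi>"
    and "\<And>i. i \<in> {1..n} \<Longrightarrow> \<phi> (S i) = \<psi> (S i)"
  shows "\<phi> = \<psi>"
proof -
  have cont: "continuous_on UNIV \<theta>" if "unital_star_endomorphism \<theta>" for \<theta> :: "'a \<Rightarrow> 'a"
  proof -
    have "bounded_linear \<theta>"
    proof (rule bounded_linear_intro[where K = 1])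
      show "\<theta> (x + y) = \<theta> x + \<theta> y" for x y
        using that by (simp add: unital_star_endomorphism_def)
      show "\<theta> (r *\<^sub>R x) = r *\<^sub>R \<theta> x" for r x
        using that by (metis unital_star_endomorphism_def scaleC_of_real)
      show "norm (\<theta> x) \<le> norm x * 1" for x
        using unital_star_endomorphism_norm_le[OF that] by simp
    qed
    then show ?thesis
      by (rule linear_continuous_on)
  qed
  have "cstar_subalgebra {x. \<phi> x = \<psi> x}"
    unfolding cstar_subalgebra_def
  proof (intro conjI ballI allI)
    show "closed {x. \<phi> x = \<psi> x}"
      by (rule closed_Collect_eq[OF cont[OF assms(2)] cont[OF assms(3)]])
    have "\<theta> 0 = 0" if "unital_star_endomorphism \<theta>" for \<theta> :: "'a \<Rightarrow> 'a"
      using that by (metis unital_star_endomorphism_def scaleC_zero_left)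
    from this[OF assms(2)] this[OF assms(3)] show "0 \<in> {x. \<phi> x = \<psi> x}"
      by simp
  qed (use assms(2,3) in \<open>auto simp: unital_star_endomorphism_def\<close>)
  then have "{x. \<phi> x = \<psi> x} = UNIV"
    using assms(1,4) by (intro cuntz_algebra_subalgebra_eq_UNIV) auto
  then show ?thesis
    by auto
qed

section \<open>The maps on words\<close>

locale word_permutation =
  fixes n l :: nat and \<sigma> :: "nat list \<Rightarrow> nat list"
  assumes permutes: "\<sigma> permutes words n (Suc l)"
begin

abbreviation f :: "nat \<Rightarrow> nat list \<Rightarrow> nat list" where
  "f \<equiv> f_map n (Suc l) \<sigma>"

abbreviation F :: "nat \<times> nat \<Rightarrow> (nat list \<times> nat list) option \<Rightarrow> (nat list \<times> nat list) option" where
  "F \<equiv> (\<lambda>(i, j). f2_map n (Suc l) \<sigma> i j)"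

lemma permutation_in_words: "\<xi> \<in> words n (Suc l) \<Longrightarrow> \<sigma> \<xi> \<in> words n (Suc l)"
  using permutes_in_image[OF permutes] by blast

lemma permutation_eq_iff: "\<sigma> \<xi> = \<sigma> \<eta> \<longleftrightarrow> \<xi> = \<eta>"
  using permutes_inj[OF permutes] by (simp add: inj_eq)

lemma preimageE:
  assumes "i \<in> {1..n}" "\<alpha> \<in> words n l"
  obtains \<gamma> m where "\<gamma> \<in> words n l" "m \<in> {1..n}" "i # \<alpha> = \<sigma> (\<gamma> @ [m])"
proof -
  have "i # \<alpha> \<in> \<sigma> ` words n (Suc l)"
    using assms permutes_image[OF permutes] by simp
  then obtain \<xi> where "\<xi> \<in> words n (Suc l)" "i # \<alpha> = \<sigma> \<xi>"
    by blast
  then show ?thesis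
    using that by (elim words_SucE_snoc) auto
qed

lemma f_eq:
  assumes "\<gamma> \<in> words n l" "m \<in> {1..n}" "i # \<alpha> = \<sigma> (\<gamma> @ [m])"
  shows "f i \<alpha> = \<gamma>"
  unfolding f_map_def using assms by (intro the_equality) (auto simp: permutation_eq_iff)

lemma f_in_words: "i \<in> {1..n} \<Longrightarrow> \<alpha> \<in> words n l \<Longrightarrow> f i \<alpha> \<in> words n l"
  by (metis preimageE f_eq)

lemma F_None [simp]: "F p None = None"
  by (simp add: f2_map_def split: prod.split)

lemma F_eq:
  assumes "\<gamma> \<in> words n l" "m \<in> {1..n}" "i # \<alpha> = \<sigma> (\<gamma> @ [m])"
    and "\<delta> \<in> words n l" "m' \<in> {1..n}" "j # \<beta> = \<sigma> (\<delta> @ [m'])"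
  shows "F (i, j) (Some (\<alpha>, \<beta>)) = (if m = m' then Some (\<gamma>, \<delta>) else None)"
proof -
  have rel: "f2_rel n (Suc l) \<sigma> i j (\<alpha>, \<beta>) q \<longleftrightarrow> m = m' \<and> q = (\<gamma>, \<delta>)" for q
    using assms by (cases q) (auto simp: f2_rel_def permutation_eq_iff)
  show ?thesis
    by (auto simp: f2_map_def rel)
qed

lemma F_equal_indices:
  assumes "i \<in> {1..n}" "\<alpha> \<in> words n l"
  shows "F (i, i) (Some (\<alpha>, \<alpha>)) = Some (f i \<alpha>, f i \<alpha>)"
  using assms
proof (rule preimageE)
  fix \<gamma> m
  assume a: "\<gamma> \<in> words n l" "m \<in> {1..n}" "i # \<alpha> = \<sigma> (\<gamma> @ [m])"
  show ?thesis
    unfolding F_eq[OF a a] f_eq[OF a] by simp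
qed

text \<open>Since \<open>\<sigma>\<close> is injective, the diagonal is only reached from the diagonal, with equal indices.\<close>

lemma F_off_diagonal:
  assumes "i \<in> {1..n}" "j \<in> {1..n}" "\<alpha> \<in> words n l" "\<beta> \<in> words n l" "i \<noteq> j \<or> \<alpha> \<noteq> \<beta>"
  shows "F (i, j) (Some (\<alpha>, \<beta>)) \<in> pairs_dagger n l"
proof -
  obtain \<gamma> m where 1: "\<gamma> \<in> words n l" "m \<in> {1..n}" "i # \<alpha> = \<sigma> (\<gamma> @ [m])"
    using assms(1,3) by (rule preimageE)
  obtain \<delta> m' where 2: "\<delta> \<in> words n l" "m' \<in> {1..n}" "j # \<beta> = \<sigma> (\<delta> @ [m'])"
    using assms(2,4) by (rule preimageE)
  have "i # \<alpha> \<noteq> j # \<beta>"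
    using assms(5) by simp
  then have "\<gamma> \<noteq> \<delta>" if "m = m'"
    unfolding 1(3) 2(3) using that by blast
  then show ?thesis
    unfolding F_eq[OF 1 2] using 1(1) 2(1) by (simp add: pairs_dagger_def)
qed

lemma F_in_pairs_dagger:
  assumes "p \<in> {1..n} \<times> {1..n}" "x \<in> pairs_dagger n l"
  shows "F p x \<in> pairs_dagger n l"
proof (cases x)
  case None
  then show ?thesis
    using assms by simp
next
  case (Some q)
  then show ?thesis
    using assms F_off_diagonal by (cases q; cases p) (auto simp: pairs_dagger_def)
qed

lemma foldr_f_in_words:
  "set u \<subseteq> {1..n} \<Longrightarrow> \<alpha> \<in> words n l \<Longrightarrow> foldr f u \<alpha> \<in> words n l"
  by (induction u) (auto intro: f_in_words)

lemma foldr_F_None [simp]: "foldr F u None = None"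
proof (induction u)
  case (Cons p u)
  then show ?case
    using F_None by (simp only: foldr_Cons o_apply)
qed simp

lemma foldr_F_in_pairs_dagger:
  "set u \<subseteq> {1..n} \<times> {1..n} \<Longrightarrow> x \<in> pairs_dagger n l \<Longrightarrow> foldr F u x \<in> pairs_dagger n l"
proof (induction u)
  case (Cons p u)
  then have "F p (foldr F u x) \<in> pairs_dagger n l"
    by (intro F_in_pairs_dagger) auto
  then show ?case
    by (simp only: foldr_Cons o_apply)
qed simp

lemma foldr_F_diagonal:
  "set u \<subseteq> {1..n} \<Longrightarrow> \<alpha> \<in> words n l \<Longrightarrow>
    foldr F (zip u u) (Some (\<alpha>, \<alpha>)) = Some (foldr f u \<alpha>, foldr f u \<alpha>)"
proof (induction u)
  case (Cons i u)
  have "foldr F (zip (i # u) (i # u)) (Some (\<alpha>, \<alpha>)) = F (i, i) (foldr F (zip u u) (Some (\<alpha>, \<alpha>)))"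
    by simp
  also have "\<dots> = F (i, i) (Some (foldr f u \<alpha>, foldr f u \<alpha>))"
    using Cons by simp
  also have "\<dots> = Some (foldr f (i # u) \<alpha>, foldr f (i # u) \<alpha>)"
    using F_equal_indices[of i "foldr f u \<alpha>"] foldr_f_in_words[of u \<alpha>] Cons.prems by simp
  finally show ?case .
qed simp

lemma foldr_F_leaves_diagonal:
  assumes "set u \<subseteq> {1..n} \<times> {1..n}" "\<alpha> \<in> words n l" "\<nexists>v. u = zip v v"
  shows "foldr F u (Some (\<alpha>, \<alpha>)) \<in> pairs_dagger n l"
  using assms
proof (induction u)
  case Nil
  then show ?case
    by (metis zip_Nil)
next
  case (Cons p u)
  obtain i j where p: "p = (i, j)" "i \<in> {1..n}" "j \<in> {1..n}"
    using Cons.prems(1) by auto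
  have "F p (foldr F u (Some (\<alpha>, \<alpha>))) \<in> pairs_dagger n l"
  proof (cases "\<exists>v. u = zip v v")
    case True
    then obtain v where v: "u = zip v v"
      by blast
    define v' where "v' = map fst u"
    have v': "u = zip v' v'" "set v' \<subseteq> {1..n}"
    proof -
      have "map fst u = v"
        using v by simp
      then show "u = zip v' v'"
        using v by (simp add: v'_def)
      show "set v' \<subseteq> {1..n}"
        using Cons.prems(1) by (auto simp: v'_def)
    qed
    have "i \<noteq> j"
      using Cons.prems(3) v p by (metis zip_Cons_Cons)
    then show ?thesis
      unfolding v'(1) foldr_F_diagonal[OF v'(2) Cons.prems(2)]
      using F_off_diagonal p foldr_f_in_words[OF v'(2) Cons.prems(2)] by simp
  next
    case False
    then show ?thesis
      using Cons by (intro F_in_pairs_dagger) auto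
  qed
  then show ?case
    by (simp only: foldr_Cons o_apply)
qed

text \<open>Words of indices act by \<open>foldr\<close>, the last letter first. The following two properties are what
  the two orders in the criterion amount to.\<close>

definition merging :: "nat \<Rightarrow> bool" where
  "merging M \<longleftrightarrow> (\<forall>u\<in>words n M. \<forall>\<alpha>\<in>words n l. \<forall>\<beta>\<in>words n l. foldr f u \<alpha> = foldr f u \<beta>)"

definition separating :: "nat \<Rightarrow> bool" where
  "separating M \<longleftrightarrow> (\<forall>u. length u = M \<longrightarrow> set u \<subseteq> {1..n} \<times> {1..n} \<longrightarrow>
     (\<forall>x\<in>pairs_dagger n l. foldr F u x = None))"

text \<open>On the diagonal, \<open>M\<close> steps with equal indices forget the starting point, whereas a step with
  different indices leaves the diagonal, and then further \<open>M\<close> steps lead to \<open>None\<close>.\<close>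

lemma foldr_F_diagonal_constant:
  assumes "merging M" "separating M" "length u = M + M" "set u \<subseteq> {1..n} \<times> {1..n}"
    and w: "\<alpha> \<in> words n l" "\<beta> \<in> words n l"
  shows "foldr F u (Some (\<alpha>, \<alpha>)) = foldr F u (Some (\<beta>, \<beta>))"
proof -
  define u1 where "u1 = take M u"
  define u2 where "u2 = drop M u"
  have u: "u = u1 @ u2"
    by (simp add: u1_def u2_def)
  have len: "length u1 = M" "length u2 = M"
    using assms(3) by (auto simp: u1_def u2_def)
  have set: "set u1 \<subseteq> {1..n} \<times> {1..n}" "set u2 \<subseteq> {1..n} \<times> {1..n}"
    using assms(4) u by auto
  show ?thesis
  proof (cases "\<exists>v. u2 = zip v v")
    case True
    then obtain v where v: "u2 = zip v v"
      by blast
    have "v = map fst u2"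
      using v by simp
    then have vw: "v \<in> words n M"
      using len set(2) by (auto simp: words_def)
    then have eq: "foldr f v \<alpha> = foldr f v \<beta>"
      using assms(1) w unfolding merging_def by blast
    have "set v \<subseteq> {1..n}"
      using vw by (simp add: words_def)
    then show ?thesis
      unfolding u foldr_append o_apply v by (simp only: foldr_F_diagonal w eq)
  next
    case False
    then have "foldr F u2 (Some (\<gamma>, \<gamma>)) \<in> pairs_dagger n l" if "\<gamma> \<in> words n l" for \<gamma>
      using foldr_F_leaves_diagonal[OF set(2) that] by blast
    then have "foldr F u1 (foldr F u2 (Some (\<gamma>, \<gamma>))) = None" if "\<gamma> \<in> words n l" for \<gamma>
      using assms(2) len(1) set(1) that unfolding separating_def by blast
    then show ?thesis
      unfolding u foldr_append o_apply by (simp only: w)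
  qed
qed

lemma merging_mono:
  assumes "merging M" "M \<le> N"
  shows "merging N"
  unfolding merging_def
proof (intro ballI)
  fix u \<alpha> \<beta>
  assume u: "u \<in> words n N" and w: "\<alpha> \<in> words n l" "\<beta> \<in> words n l"
  have eq: "u = take (N - M) u @ drop (N - M) u"
    by simp
  have "drop (N - M) u \<in> words n M"
    using u assms(2) set_drop_subset[of "N - M" u] by (auto simp: words_def)
  then have "foldr f (drop (N - M) u) \<alpha> = foldr f (drop (N - M) u) \<beta>"
    using assms(1) w unfolding merging_def by blast
  then show "foldr f u \<alpha> = foldr f u \<beta>"
    by (subst (1 2) eq) (simp only: foldr_append o_apply)
qed

lemma separating_mono:
  assumes "separating M" "M \<le> N"
  shows "separating N"
  unfolding separating_def
proof (intro allI impI ballI)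
  fix u x
  assume u: "length u = N" "set u \<subseteq> {1..n} \<times> {1..n}" and x: "x \<in> pairs_dagger n l"
  have eq: "u = take (N - M) u @ drop (N - M) u"
    by simp
  have "length (drop (N - M) u) = M" "set (drop (N - M) u) \<subseteq> {1..n} \<times> {1..n}"
    using u assms(2) set_drop_subset[of "N - M" u] by auto
  then have "foldr F (drop (N - M) u) x = None"
    using assms(1) x unfolding separating_def by blast
  then show "foldr F u x = None"
    by (subst eq) (simp only: foldr_append o_apply foldr_F_None)
qed

end

section \<open>Surjectivity of the endomorphism of a permutation\<close>

lemma cstar_subalgebra_sum:
  assumes "cstar_subalgebra B" "\<And>i. i \<in> I \<Longrightarrow> g i \<in> B"
  shows "(\<Sum>i\<in>I. g i) \<in> B"
  using assms by (induction I rule: infinite_finite_induct) (auto simp: cstar_subalgebra_def)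

lemma cstar_subalgebra_range:
  assumes endo: "unital_star_endomorphism \<phi>" and iso: "\<And>x. norm (\<phi> x) = norm x"
  shows "cstar_subalgebra (range \<phi>)"
proof -
  have add: "\<phi> (x + y) = \<phi> x + \<phi> y" and sc: "\<phi> (scaleC c x) = scaleC c (\<phi> x)"
    and mult: "\<phi> (x * y) = \<phi> x * \<phi> y" and st: "\<phi> (star x) = star (\<phi> x)" for x y c
    using endo by (auto simp: unital_star_endomorphism_def)
  have "\<phi> (x - y) = \<phi> x - \<phi> y" for x y
    by (metis add diff_add_cancel add_diff_cancel)
  then have dist: "dist (\<phi> x) (\<phi> y) = dist x y" for x y
    by (metis iso dist_norm)
  have "closed (range \<phi>)"
    unfolding closed_sequential_limits
  proof (intro allI impI, elim conjE)
    fix Y y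
    assume Y: "\<forall>m. Y m \<in> range \<phi>" "Y \<longlonglongrightarrow> y"
    then have "\<forall>m. \<exists>x. Y m = \<phi> x"
      by blast
    then obtain X where X: "\<And>m. Y m = \<phi> (X m)"
      by metis
    have "Cauchy X"
      using LIMSEQ_imp_Cauchy[OF Y(2)] by (simp add: Cauchy_def X dist)
    then obtain x where x: "X \<longlonglongrightarrow> x"
      using Cauchy_convergent_iff convergent_def by blast
    have "Y \<longlonglongrightarrow> \<phi> x"
      using x by (simp add: LIMSEQ_def X dist)
    then show "y \<in> range \<phi>"
      using LIMSEQ_unique[OF Y(2)] by blast
  qed
  moreover have "0 \<in> range \<phi>"
    using sc[of 0 0] by (metis rangeI scaleC_zero_left)
  moreover have "x + y \<in> range \<phi>" "x * y \<in> range \<phi>" if "x \<in> range \<phi>" "y \<in> range \<phi>" for x y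
    using that by (auto simp flip: add mult)
  moreover have "scaleC c x \<in> range \<phi>" "star x \<in> range \<phi>" if "x \<in> range \<phi>" for c x
    using that by (auto simp flip: sc st)
  ultimately show ?thesis
    by (simp add: cstar_subalgebra_def)
qed

locale permutation_endomorphism = cuntz_family n S + word_permutation n l \<sigma>
  for n :: nat and S :: "nat \<Rightarrow> 'a::cstar_algebra" and l :: nat and \<sigma> :: "nat list \<Rightarrow> nat list"
begin

abbreviation w :: 'a where
  "w \<equiv> perm_unitary n (Suc l) S \<sigma>"

definition T :: "nat \<Rightarrow> 'a" where
  "T i = star w * S i"

lemma perm_unitary_mult_word:
  assumes "\<alpha> \<in> words n (Suc l)"
  shows "w * S_word S \<alpha> = S_word S (\<sigma> \<alpha>)"
proof -
  have "w * S_word S \<alpha> = (\<Sum>\<beta>\<in>words n (Suc l). S_word S (\<sigma> \<beta>) * (star (S_word S \<beta>) * S_word S \<alpha>))"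
    by (simp add: perm_unitary_def sum_distrib_right mult.assoc)
  also have "\<dots> = (\<Sum>\<beta>\<in>words n (Suc l). if \<beta> = \<alpha> then S_word S (\<sigma> \<beta>) else 0)"
    by (intro sum.cong refl) (simp add: S_word_star_mult[OF _ assms])
  finally show ?thesis
    using assms by simp
qed

lemma star_perm_unitary_mult_word:
  assumes "\<alpha> \<in> words n (Suc l)"
  shows "star w * S_word S (\<sigma> \<alpha>) = S_word S \<alpha>"
proof -
  have "star w * S_word S (\<sigma> \<alpha>) =
      (\<Sum>\<beta>\<in>words n (Suc l). S_word S \<beta> * (star (S_word S (\<sigma> \<beta>)) * S_word S (\<sigma> \<alpha>)))"
    by (simp add: perm_unitary_def star_sum star_mult star_star sum_distrib_right mult.assoc)
  also have "\<dots> = (\<Sum>\<beta>\<in>words n (Suc l). if \<beta> = \<alpha> then S_word S \<beta> else 0)"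
    by (intro sum.cong refl)
      (simp add: S_word_star_mult[OF permutation_in_words permutation_in_words[OF assms]] permutation_eq_iff)
  finally show ?thesis
    using assms by simp
qed

lemma perm_unitary_isometry: "star w * w = 1"
proof -
  have "star w * w = (\<Sum>\<alpha>\<in>words n (Suc l). star w * S_word S (\<sigma> \<alpha>) * star (S_word S \<alpha>))"
    by (subst (2) perm_unitary_def) (simp add: sum_distrib_left mult.assoc)
  also have "\<dots> = (\<Sum>\<alpha>\<in>words n (Suc l). S_word S \<alpha> * star (S_word S \<alpha>))"
    by (intro sum.cong refl) (simp add: star_perm_unitary_mult_word)
  finally show ?thesis
    by (simp add: sum_word_ranges)
qed

lemma perm_unitary_coisometry: "w * star w = 1"
proof -
  have "w * star w = (\<Sum>\<alpha>\<in>words n (Suc l). w * S_word S \<alpha> * star (S_word S (\<sigma> \<alpha>)))"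
    by (subst (2) perm_unitary_def) (simp add: star_sum star_mult star_star sum_distrib_left mult.assoc)
  also have "\<dots> = (\<Sum>\<alpha>\<in>words n (Suc l). S_word S (\<sigma> \<alpha>) * star (S_word S (\<sigma> \<alpha>)))"
    by (intro sum.cong refl) (simp add: perm_unitary_mult_word)
  also have "\<dots> = (\<Sum>\<alpha>\<in>words n (Suc l). S_word S \<alpha> * star (S_word S \<alpha>))"
    using sum.permute[OF permutes, of "\<lambda>\<alpha>. S_word S \<alpha> * star (S_word S \<alpha>)"] by (simp add: o_def)
  finally show ?thesis
    by (simp add: sum_word_ranges)
qed

lemma perm_unitary_eq_word_comb:
  "w = word_comb n S (Suc l) (Suc l) (\<lambda>\<alpha> \<beta>. if \<alpha> = \<sigma> \<beta> then 1 else 0)"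
proof (rule word_comb_eqI)
  fix \<alpha> \<beta>
  assume "\<alpha> \<in> words n (Suc l)" "\<beta> \<in> words n (Suc l)"
  then show "star (S_word S \<alpha>) * w * S_word S \<beta> = scaleC (if \<alpha> = \<sigma> \<beta> then 1 else 0) 1"
    by (simp add: mult.assoc perm_unitary_mult_word S_word_star_mult permutation_in_words)
qed

lemma cuntz_family_T: "cuntz_family n T"
proof
  show "star (T i) * T i = 1" if "i \<in> {1..n}" for i
  proof -
    have "star (T i) * T i = star (S i) * (w * star w) * S i"
      by (simp add: T_def star_mult star_star mult.assoc)
    then show ?thesis
      using isometry[OF that] by (simp add: perm_unitary_coisometry)
  qed
  have "(\<Sum>i\<in>{1..n}. T i * star (T i)) = star w * (\<Sum>i\<in>{1..n}. S i * star (S i)) * w"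
    by (simp add: T_def star_mult star_star sum_distrib_left sum_distrib_right mult.assoc)
  then show "(\<Sum>i\<in>{1..n}. T i * star (T i)) = 1"
    by (simp only: sum_ranges mult_1_right perm_unitary_isometry)
qed (rule two_le_n)

sublocale T: cuntz_family n T
  by (rule cuntz_family_T)

subsection \<open>Compressions of local elements\<close>

definition local :: "((nat list \<times> nat list) option \<Rightarrow> complex) \<Rightarrow> 'a" where
  "local h = word_comb n S l l (\<lambda>\<alpha> \<beta>. h (Some (\<alpha>, \<beta>)))"

text \<open>An element of the matrix algebra spanned by the units with words of length \<open>l\<close> is given by the
  function \<open>h\<close> of its entries. With the convention \<open>h None = 0\<close>, compression by \<open>T i\<close> and \<open>T j\<close>
  composes \<open>h\<close> with \<open>F (i, j)\<close>: this is the link between the algebra and the maps on words.\<close>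

lemma T_mult_word:
  assumes "\<gamma> \<in> words n l" "m \<in> {1..n}" "i # \<alpha> = \<sigma> (\<gamma> @ [m])"
  shows "T i * S_word S \<alpha> = S_word S \<gamma> * S m"
proof -
  have "T i * S_word S \<alpha> = star w * S_word S (i # \<alpha>)"
    by (simp add: T_def mult.assoc)
  also have "\<dots> = star w * S_word S (\<sigma> (\<gamma> @ [m]))"
    by (simp only: assms(3))
  also have "\<dots> = S_word S (\<gamma> @ [m])"
    by (rule star_perm_unitary_mult_word) (use assms in simp)
  finally show ?thesis
    by (simp add: S_word_append)
qed

lemma T_compression:
  assumes h: "h None = 0" and ij: "i \<in> {1..n}" "j \<in> {1..n}"
  shows "star (T i) * local h * T j = local (h \<circ> F (i, j))"
  unfolding local_def[of "h \<circ> F (i, j)"]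
proof (rule word_comb_eqI)
  fix \<alpha> \<beta>
  assume w: "\<alpha> \<in> words n l" "\<beta> \<in> words n l"
  obtain \<gamma> m where 1: "\<gamma> \<in> words n l" "m \<in> {1..n}" "i # \<alpha> = \<sigma> (\<gamma> @ [m])"
    using ij(1) w(1) by (rule preimageE)
  obtain \<delta> m' where 2: "\<delta> \<in> words n l" "m' \<in> {1..n}" "j # \<beta> = \<sigma> (\<delta> @ [m'])"
    using ij(2) w(2) by (rule preimageE)
  have T1: "T i * S_word S \<alpha> = S_word S \<gamma> * S m"
    by (rule T_mult_word[OF 1])
  have T2: "T j * S_word S \<beta> = S_word S \<delta> * S m'"
    by (rule T_mult_word[OF 2])
  have "star (S_word S \<alpha>) * (star (T i) * local h * T j) * S_word S \<beta> =
      star (T i * S_word S \<alpha>) * local h * (T j * S_word S \<beta>)"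
    by (simp add: star_mult mult.assoc)
  also have "\<dots> = star (S m) * (star (S_word S \<gamma>) * local h * S_word S \<delta>) * S m'"
    unfolding T1 T2 by (simp add: star_mult mult.assoc)
  also have "\<dots> = scaleC (h (Some (\<gamma>, \<delta>))) (star (S m) * S m')"
    unfolding local_def using 1(1) 2(1) by (simp add: word_comb_entry scaleC_mult_left scaleC_mult_right)
  also have "\<dots> = scaleC (h (if m = m' then Some (\<gamma>, \<delta>) else None)) 1"
    using 1(2) 2(2) h isometry isometries_orthogonal by simp
  also have "\<dots> = scaleC ((h \<circ> F (i, j)) (Some (\<alpha>, \<beta>))) 1"
    by (simp only: o_apply F_eq[OF 1 2])
  finally show "star (S_word S \<alpha>) * (star (T i) * local h * T j) * S_word S \<beta> =
      scaleC ((h \<circ> F (i, j)) (Some (\<alpha>, \<beta>))) 1" .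
qed

lemma T_word_compression:
  assumes "length u = length v" "set u \<subseteq> {1..n}" "set v \<subseteq> {1..n}" "h None = 0"
  shows "star (S_word T u) * local h * S_word T v = local (h \<circ> foldr F (zip u v))"
  using assms
proof (induction u v arbitrary: h rule: list_induct2)
  case Nil
  then show ?case
    by (simp add: o_def)
next
  case (Cons i u j v)
  have "star (S_word T (i # u)) * local h * S_word T (j # v) =
      star (S_word T u) * (star (T i) * local h * T j) * S_word T v"
    by (simp add: star_mult mult.assoc)
  also have "star (T i) * local h * T j = local (h \<circ> F (i, j))"
    by (rule T_compression) (use Cons.prems in auto)
  also have "star (S_word T u) * local (h \<circ> F (i, j)) * S_word T v =
      local (h \<circ> F (i, j) \<circ> foldr F (zip u v))"
    by (rule Cons.IH) (use Cons.prems in \<open>auto simp: f2_map_def\<close>)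
  finally show ?case
    by (simp only: zip_Cons_Cons foldr_Cons o_assoc)
qed

lemma ex_local:
  obtains h where "word_comb n S l l c = local h" "h None = 0"
  using that[of "case_option 0 (case_prod c)"] by (simp add: local_def)

lemma scalar_eq_word_comb: "scaleC z 1 = word_comb n S a a (\<lambda>\<alpha> \<beta>. if \<alpha> = \<beta> then z else 0)"
  by (rule word_comb_eqI) (simp add: scaleC_mult_left scaleC_mult_right S_word_star_mult)

end

context permutation_endomorphism
begin

text \<open>By the combinatorial conditions, all off-diagonal entries of a long compression vanish and
  its diagonal entries agree.\<close>

lemma long_compression_scalar:
  assumes "merging M" "separating M" "h None = 0" "u \<in> words n (M + M)" "v \<in> words n (M + M)"
  obtains z where "star (S_word T u) * local h * S_word T v = scaleC z 1"
proof -
  define g where "g = h \<circ> foldr F (zip u v)"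
  have len: "length (zip u v) = M + M" and set: "set (zip u v) \<subseteq> {1..n} \<times> {1..n}"
    using assms(4,5) by (auto simp: words_def dest: set_zip_leftD set_zip_rightD)
  have off: "g (Some (\<alpha>, \<beta>)) = 0" if "\<alpha> \<in> words n l" "\<beta> \<in> words n l" "\<alpha> \<noteq> \<beta>" for \<alpha> \<beta>
  proof -
    have "Some (\<alpha>, \<beta>) \<in> pairs_dagger n l"
      using that by (simp add: pairs_dagger_def)
    moreover have "separating (M + M)"
      using assms(2) by (rule separating_mono) simp
    ultimately have "foldr F (zip u v) (Some (\<alpha>, \<beta>)) = None"
      using len set unfolding separating_def by blast
    then show ?thesis
      by (simp only: g_def o_apply assms(3))
  qed
  define \<omega> where "\<omega> = replicate l (1::nat)"
  have \<omega>: "\<omega> \<in> words n l"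
    using two_le_n by (auto simp: \<omega>_def words_def)
  have diag: "g (Some (\<alpha>, \<alpha>)) = g (Some (\<omega>, \<omega>))" if "\<alpha> \<in> words n l" for \<alpha>
    unfolding g_def o_apply
    using foldr_F_diagonal_constant[OF assms(1,2) len set that \<omega>] by (rule arg_cong)
  have "star (S_word T u) * local h * S_word T v = local g"
    unfolding g_def by (rule T_word_compression) (use assms in \<open>auto simp: words_def\<close>)
  also have "local g = word_comb n S l l (\<lambda>\<alpha> \<beta>. if \<alpha> = \<beta> then g (Some (\<omega>, \<omega>)) else 0)"
    unfolding local_def by (rule word_comb_cong) (simp add: off diag)
  also have "\<dots> = scaleC (g (Some (\<omega>, \<omega>))) 1"
    by (rule scalar_eq_word_comb[symmetric])
  finally show ?thesis
    by (rule that)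
qed

text \<open>\<open>B\<close> contains the local elements, as they are combinations of products of \<open>T\<close>-words and their
  adjoints with scalar coefficients; hence it contains \<open>w\<close>, whose compressions by the \<open>T i\<close> are local, and the
  generators \<open>S i = w * T i\<close>.\<close>

lemma subalgebra_eq_UNIV:
  assumes cuntz: "cuntz_algebra n S" and B: "cstar_subalgebra B" "1 \<in> B" "T ` {1..n} \<subseteq> B"
    and comb: "merging M" "separating M"
  shows "B = UNIV"
proof -
  have mult: "\<And>x y. x \<in> B \<Longrightarrow> y \<in> B \<Longrightarrow> x * y \<in> B" and st: "\<And>x. x \<in> B \<Longrightarrow> star x \<in> B"
    and sc: "\<And>c x. x \<in> B \<Longrightarrow> scaleC c x \<in> B"
    using B(1) by (auto simp: cstar_subalgebra_def)
  have TB: "T i \<in> B" if "i \<in> {1..n}" for i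
    using B(3) that by blast
  have word: "S_word T u \<in> B" if "set u \<subseteq> {1..n}" for u
    using that by (induction u) (auto intro!: mult TB simp: B(2))
  have word_sum: "x \<in> B"
    if "\<And>u v. u \<in> words n a \<Longrightarrow> v \<in> words n a \<Longrightarrow> star (S_word T u) * x * S_word T v \<in> B" for x a
  proof -
    have "(\<Sum>u\<in>words n a. \<Sum>v\<in>words n a.
        S_word T u * (star (S_word T u) * x * S_word T v) * star (S_word T v)) \<in> B"
    proof (intro cstar_subalgebra_sum[OF B(1)])
      fix u v
      assume uv: "u \<in> words n a" "v \<in> words n a"
      then have "S_word T u \<in> B" "star (S_word T v) \<in> B"
        using word st by (auto simp: words_def)
      then show "S_word T u * (star (S_word T u) * x * S_word T v) * star (S_word T v) \<in> B"
        using that[OF uv] mult by blast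
    qed
    then show "x \<in> B"
      using T.word_expansion[of x a a] by simp
  qed
  have local: "local h \<in> B" if h: "h None = 0" for h
  proof (rule word_sum)
    fix u v
    assume "u \<in> words n (M + M)" "v \<in> words n (M + M)"
    then obtain z where "star (S_word T u) * local h * S_word T v = scaleC z 1"
      using long_compression_scalar[of M h u v] comb h by blast
    then show "star (S_word T u) * local h * S_word T v \<in> B"
      using sc B(2) by simp
  qed
  have w: "w \<in> B"
  proof (rule word_sum)
    fix u v
    assume "u \<in> words n (Suc 0)" "v \<in> words n (Suc 0)"
    then obtain i j where u: "u = [i]" "i \<in> {1..n}" and v: "v = [j]" "j \<in> {1..n}"
      by (auto elim!: words_SucE_Cons)
    define c where "c \<alpha> \<beta> = (if i # \<alpha> = \<sigma> (j # \<beta>) then 1 else 0 :: complex)" for \<alpha> \<beta>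
    have "star (S_word T u) * w * S_word T v = star (S i) * w * S j"
    proof -
      have "star (S_word T u) * w * S_word T v = star (S i) * w * (w * star w) * S j"
        by (simp add: u v T_def star_mult star_star mult.assoc)
      then show ?thesis
        by (simp add: perm_unitary_coisometry)
    qed
    also have "\<dots> = word_comb n S l l c"
    proof (rule word_comb_eqI)
      fix \<alpha> \<beta>
      assume ab: "\<alpha> \<in> words n l" "\<beta> \<in> words n l"
      have "star (S_word S \<alpha>) * (star (S i) * w * S j) * S_word S \<beta> =
          star (S_word S (i # \<alpha>)) * w * S_word S (j # \<beta>)"
        by (simp add: star_mult mult.assoc)
      also have "\<dots> = scaleC (c \<alpha> \<beta>) 1"
        using word_comb_entry[of "i # \<alpha>" "Suc l" "j # \<beta>" "Suc l" "\<lambda>\<alpha> \<beta>. if \<alpha> = \<sigma> \<beta> then 1 else 0"]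
          ab u v by (simp only: perm_unitary_eq_word_comb[symmetric] Cons_in_words c_def)
      finally show "star (S_word S \<alpha>) * (star (S i) * w * S j) * S_word S \<beta> = scaleC (c \<alpha> \<beta>) 1" .
    qed
    finally show "star (S_word T u) * w * S_word T v \<in> B"
      using ex_local local by metis
  qed
  have "S i \<in> B" if "i \<in> {1..n}" for i
  proof -
    have "w * T i = S i"
      using perm_unitary_coisometry by (simp add: T_def flip: mult.assoc)
    then show ?thesis
      using mult[OF w TB[OF that]] by simp
  qed
  then show ?thesis
    by (intro cuntz_algebra_subalgebra_eq_UNIV[OF cuntz B(1)]) blast
qed

subsection \<open>Approximation of local elements\<close>

text \<open>In terms of the \<open>S i\<close>, the word \<open>S_word T u\<close> is homogeneous of degree \<open>length u\<close>.\<close>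

lemma T_word_comb_homogeneous:
  obtains d where "word_comb n T a b c = word_comb n S (a + l) (b + l) d"
proof -
  interpret SS: cuntz_pair n S S
    by unfold_locales
  have W: "SS.homog_pair (Suc l) (Suc l) w w"
    unfolding SS.homog_pair_def using perm_unitary_eq_word_comb by blast
  have T: "SS.homog_pair (Suc l) l (T i) (T i)" if "i \<in> {1..n}" for i
    unfolding T_def
    by (rule SS.homog_pair_mult[OF SS.homog_pair_star[OF W]
          SS.homog_pair_shift_to[OF SS.homog_pair_isometry[OF that]]]) simp_all
  have word: "SS.homog_pair (length u + l) l (S_word T u) (S_word T u)" if "set u \<subseteq> {1..n}" for u
    using that
  proof (induction u)
    case Nil
    then show ?case
      by (simp add: SS.homog_pair_one)
  next
    case (Cons i u)
    have "SS.homog_pair (length (i # u) + l) (length u + l) (T i) (T i)"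
      by (rule SS.homog_pair_shift_to[OF T, where t = "length u"]) (use Cons.prems in auto)
    then show ?case
      unfolding S_word_Cons by (rule SS.homog_pair_mult) (use Cons in auto)
  qed
  have "SS.homog_pair (a + l) (b + l) (word_comb n T a b c) (word_comb n T a b c)"
    unfolding word_comb_def
  proof (intro SS.homog_pair_sum SS.homog_pair_scaleC)
    fix u v
    assume "u \<in> words n a" "v \<in> words n b"
    then show "SS.homog_pair (a + l) (b + l) (S_word T u * star (S_word T v)) (S_word T u * star (S_word T v))"
      using SS.homog_pair_mult[OF word[of u] SS.homog_pair_star[OF word[of v]]] by (auto simp: words_def)
  qed
  then show ?thesis
    using that unfolding SS.homog_pair_def by blast
qed

text \<open>Suppose that a local element is close to a polynomial in the \<open>T i\<close>. By homogeneity it is then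
  close to the component of degree zero, whose long compressions are scalars.\<close>

lemma compression_near_scalar:
  assumes y: "cuntz_pair.level_pair n S T K x' y" and near: "norm (local h - y) < \<epsilon>"
    and uv: "u \<in> words n K" "v \<in> words n K"
  obtains z where "norm (star (S_word T u) * local h * S_word T v - scaleC z 1) < \<epsilon>"
proof -
  interpret ST: cuntz_pair n S T
    by unfold_locales
  interpret SS: cuntz_pair n S S
    by unfold_locales
  obtain y' where y': "y = (\<Sum>a\<le>2 * K. y' a)" and hom: "\<And>a. a \<le> 2 * K \<Longrightarrow> \<exists>c. y' a = word_comb n T a K c"
    using y unfolding ST.level_pair_def ST.homog_pair_def by blast
  obtain c where c: "y' K = word_comb n T K K c"
    using hom[of K] by auto
  have "SS.homog_pair l l (local h) (local h)"
    unfolding local_def by (rule SS.homog_pair_word_comb)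
  then have "SS.homog_pair (K + l) (K + l) (local h) (local h)"
    by (rule SS.homog_pair_shift_to[where t = K]) simp_all
  then obtain d0 where d0: "local h = word_comb n S (K + l) (K + l) d0"
    unfolding SS.homog_pair_def by blast
  \<comment> \<open>The index \<open>a\<close> stands for the degree \<open>a - K\<close>, so that \<open>local h\<close> belongs to \<open>a = K\<close>.\<close>
  have "\<exists>d. (if a = K then local h else 0) - y' a = word_comb n S (a + l) (K + l) d" if le: "a \<le> 2 * K" for a
  proof -
    obtain c' where "y' a = word_comb n T a K c'"
      using hom[OF le] by blast
    moreover obtain d where "word_comb n T a K c' = word_comb n S (a + l) (K + l) d"
      by (rule T_word_comb_homogeneous)
    ultimately have "SS.homog_pair (a + l) (K + l) (y' a) (y' a)"
      unfolding SS.homog_pair_def by auto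
    then have neg: "SS.homog_pair (a + l) (K + l) (- y' a) (- y' a)"
      using SS.homog_pair_scaleC[of _ _ "y' a" "y' a" "-1"] by (simp add: scaleC_minus_left)
    have "SS.homog_pair (a + l) (K + l) (if a = K then local h else 0) (if a = K then local h else 0)"
      using d0 SS.homog_pair_word_comb[of "K + l" "K + l" d0] SS.homog_pair_zero by simp
    from SS.homog_pair_add[OF this neg] show ?thesis
      unfolding SS.homog_pair_def by auto
  qed
  then obtain d where d: "\<And>a. a \<le> 2 * K \<Longrightarrow>
      (if a = K then local h else 0) - y' a = word_comb n S (a + l) (K + l) (d a)"
    by metis
  have sum: "local h - y = (\<Sum>a\<le>2 * K. word_comb n S (a + l) (K + l) (d a))"
  proof -
    have "(\<Sum>a\<le>2 * K. word_comb n S (a + l) (K + l) (d a)) =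
        (\<Sum>a\<le>2 * K. (if a = K then local h else 0) - y' a)"
      by (intro sum.cong refl) (simp add: d)
    then show ?thesis
      by (simp add: sum_subtractf y')
  qed
  have "norm (word_comb n S (K + l) (K + l) (d K)) \<le> norm (local h - y)"
    unfolding sum by (rule norm_component_le[where len = "\<lambda>a. a + l"]) (auto simp: inj_on_def)
  then have "norm (local h - y' K) < \<epsilon>"
    using near d[of K] by simp
  then have "norm (star (S_word T u) * (local h - y' K) * S_word T v) < \<epsilon>"
    using T.norm_compression_le[OF uv, of "local h - y' K"] by linarith
  moreover have "star (S_word T u) * (local h - y' K) * S_word T v =
      star (S_word T u) * local h * S_word T v - scaleC (c u v) 1"
    using T.word_comb_entry[OF uv, of c] by (simp add: c right_diff_distrib left_diff_distrib)
  ultimately show ?thesis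
    using that by simp
qed

text \<open>Compressing further keeps the distance, and a scalar is compressed to a scalar, as
  \<open>star (S_word T u) * S_word T v\<close> is \<open>1\<close> or \<open>0\<close> for words of equal length.\<close>

lemma compression_near_scalar_mono:
  assumes near: "\<And>u v. u \<in> words n K \<Longrightarrow> v \<in> words n K \<Longrightarrow>
      \<exists>z. norm (star (S_word T u) * x * S_word T v - scaleC z 1) < \<epsilon>"
    and "K \<le> L" and uv: "u \<in> words n L" "v \<in> words n L"
  shows "\<exists>z. norm (star (S_word T u) * x * S_word T v - scaleC z 1) < \<epsilon>"
proof -
  define u1 u2 v1 v2 where "u1 = take K u" "u2 = drop K u" "v1 = take K v" "v2 = drop K v"
  note defs = this
  have u: "u = u1 @ u2" and v: "v = v1 @ v2"
    by (simp_all add: defs)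
  have w1: "u1 \<in> words n K" "v1 \<in> words n K"
    using uv \<open>K \<le> L\<close> set_take_subset[of K u] set_take_subset[of K v] by (auto simp: defs words_def)
  have w2: "u2 \<in> words n (L - K)" "v2 \<in> words n (L - K)"
    using uv \<open>K \<le> L\<close> set_drop_subset[of K u] set_drop_subset[of K v] by (auto simp: defs words_def)
  obtain z where z: "norm (star (S_word T u1) * x * S_word T v1 - scaleC z 1) < \<epsilon>"
    using near[OF w1] by blast
  define e :: complex where "e = (if u2 = v2 then 1 else 0)"
  have "star (S_word T u2) * (star (S_word T u1) * x * S_word T v1 - scaleC z 1) * S_word T v2 =
      star (S_word T u) * x * S_word T v - scaleC z (star (S_word T u2) * S_word T v2)"
    by (simp add: u v S_word_append star_mult mult.assoc right_diff_distrib left_diff_distrib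
        scaleC_mult_left scaleC_mult_right)
  also have "star (S_word T u2) * S_word T v2 = scaleC e 1"
    by (simp add: T.S_word_star_mult[OF w2] e_def)
  finally have "norm (star (S_word T u) * x * S_word T v - scaleC (z * e) 1) \<le>
      norm (star (S_word T u1) * x * S_word T v1 - scaleC z 1)"
    using T.norm_compression_le[OF w2] by (metis scaleC_scaleC)
  then show ?thesis
    using z by (meson order_le_less_trans)
qed

lemma entry_near_scalar:
  assumes "norm (local g - scaleC z 1) < \<epsilon>" "\<alpha> \<in> words n l" "\<beta> \<in> words n l"
  shows "cmod (g (Some (\<alpha>, \<beta>)) - (if \<alpha> = \<beta> then z else 0)) < \<epsilon>"
proof -
  have "star (S_word S \<alpha>) * (local g - scaleC z 1) * S_word S \<beta> =
      scaleC (g (Some (\<alpha>, \<beta>))) 1 - scaleC z (star (S_word S \<alpha>) * S_word S \<beta>)"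
    using word_comb_entry[OF assms(2,3), of "\<lambda>\<alpha> \<beta>. g (Some (\<alpha>, \<beta>))"]
    by (simp add: local_def right_diff_distrib left_diff_distrib scaleC_mult_left scaleC_mult_right)
  also have "\<dots> = scaleC (g (Some (\<alpha>, \<beta>)) - (if \<alpha> = \<beta> then z else 0)) 1"
    by (simp add: S_word_star_mult[OF assms(2,3)] scaleC_diff_left)
  finally show ?thesis
    using norm_compression_le[OF assms(2,3), of "local g - scaleC z 1"] assms(1)
    by (simp add: norm_scaleC)
qed

text \<open>Compressions of the matrix unit at \<open>(\<mu>, \<nu>)\<close> have entries \<open>0\<close> and \<open>1\<close>.
  If they are closer than \<open>1/2\<close> to scalars, they are scalars.\<close>

lemma merging_separating_of_near_scalar:
  assumes near: "\<And>\<mu> \<nu> u v. \<mu> \<in> words n l \<Longrightarrow> \<nu> \<in> words n l \<Longrightarrow> u \<in> words n M \<Longrightarrow> v \<in> words n M \<Longrightarrow>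
    \<exists>z. norm (star (S_word T u) * local (\<lambda>x. of_bool (x = Some (\<mu>, \<nu>))) * S_word T v - scaleC z 1) < 1/2"
  shows "merging M" "separating M"
proof -
  have entry: "\<exists>z. \<forall>\<alpha>\<in>words n l. \<forall>\<beta>\<in>words n l.
      cmod (of_bool (foldr F (zip u v) (Some (\<alpha>, \<beta>)) = Some (\<mu>, \<nu>)) - (if \<alpha> = \<beta> then z else 0)) < 1/2"
    if w: "\<mu> \<in> words n l" "\<nu> \<in> words n l" "u \<in> words n M" "v \<in> words n M" for \<mu> \<nu> u v
  proof -
    define h where "h = (\<lambda>x. of_bool (x = Some (\<mu>, \<nu>)) :: complex)"
    obtain z where z: "norm (star (S_word T u) * local h * S_word T v - scaleC z 1) < 1/2"
      using near[OF w] unfolding h_def by blast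
    have "star (S_word T u) * local h * S_word T v = local (h \<circ> foldr F (zip u v))"
      by (rule T_word_compression) (use w in \<open>auto simp: words_def h_def\<close>)
    then have "cmod ((h \<circ> foldr F (zip u v)) (Some (\<alpha>, \<beta>)) - (if \<alpha> = \<beta> then z else 0)) < 1/2"
      if "\<alpha> \<in> words n l" "\<beta> \<in> words n l" for \<alpha> \<beta>
      using entry_near_scalar[of "h \<circ> foldr F (zip u v)" z "1/2" \<alpha> \<beta>] z that by simp
    then show ?thesis
      unfolding h_def o_apply by blast
  qed
  show "merging M"
    unfolding merging_def
  proof (intro ballI, rule ccontr)
    fix u \<alpha> \<beta>
    assume u: "u \<in> words n M" and w: "\<alpha> \<in> words n l" "\<beta> \<in> words n l"
      and neq: "foldr f u \<alpha> \<noteq> foldr f u \<beta>"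
    have set: "set u \<subseteq> {1..n}"
      using u by (simp add: words_def)
    define \<mu> where "\<mu> = foldr f u \<alpha>"
    have \<mu>: "\<mu> \<in> words n l"
      unfolding \<mu>_def by (rule foldr_f_in_words[OF set w(1)])
    obtain z where z: "\<forall>\<alpha>\<in>words n l. \<forall>\<beta>\<in>words n l.
      cmod (of_bool (foldr F (zip u u) (Some (\<alpha>, \<beta>)) = Some (\<mu>, \<mu>)) - (if \<alpha> = \<beta> then z else 0)) < 1/2"
      using entry[OF \<mu> \<mu> u u] by blast
    have "cmod (1 - z) < 1/2"
      using z[rule_format, OF w(1) w(1)] unfolding foldr_F_diagonal[OF set w(1)] by (simp add: \<mu>_def)
    moreover have "cmod z < 1/2"
      using z[rule_format, OF w(2) w(2)] neq unfolding foldr_F_diagonal[OF set w(2)] by (simp add: \<mu>_def)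
    moreover have "cmod 1 \<le> cmod (1 - z) + cmod z"
      by (metis diff_add_cancel norm_triangle_ineq)
    ultimately show False
      by simp
  qed
  show "separating M"
    unfolding separating_def
  proof (intro allI impI ballI, rule ccontr)
    fix u x
    assume u: "length u = M" "set u \<subseteq> {1..n} \<times> {1..n}" and x: "x \<in> pairs_dagger n l"
      and neq: "foldr F u x \<noteq> None"
    have "x \<noteq> None"
      using neq foldr_F_None by metis
    then obtain \<alpha> \<beta> where ab: "x = Some (\<alpha>, \<beta>)" "\<alpha> \<in> words n l" "\<beta> \<in> words n l" "\<alpha> \<noteq> \<beta>"
      using x by (auto simp: pairs_dagger_def)
    obtain \<mu> \<nu> where mn: "foldr F u x = Some (\<mu>, \<nu>)" "\<mu> \<in> words n l" "\<nu> \<in> words n l"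
      using foldr_F_in_pairs_dagger[OF u(2) x] neq unfolding pairs_dagger_def by blast
    have "map fst u \<in> words n M" "map snd u \<in> words n M"
      using u by (auto simp: words_def)
    from entry[OF mn(2,3) this] obtain z where "\<forall>\<alpha>\<in>words n l. \<forall>\<beta>\<in>words n l.
      cmod (of_bool (foldr F u (Some (\<alpha>, \<beta>)) = Some (\<mu>, \<nu>)) - (if \<alpha> = \<beta> then z else 0)) < 1/2"
      unfolding zip_map_fst_snd by blast
    from this[rule_format, OF ab(2,3)] show False
      using mn(1) ab(4) unfolding ab(1) by simp
  qed
qed

theorem surj_iff_merging_separating:
  assumes cuntz: "cuntz_algebra n S" and endo: "unital_star_endomorphism \<phi>"
    and iso: "\<And>x. norm (\<phi> x) = norm x" and gen: "\<And>i. i \<in> {1..n} \<Longrightarrow> \<phi> (S i) = T i"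
    and approx: "\<And>x \<epsilon>. \<epsilon> > 0 \<Longrightarrow> \<exists>K x' y'. cuntz_pair.level_pair n S T K x' y' \<and> norm (\<phi> x - y') < \<epsilon>"
  shows "surj \<phi> \<longleftrightarrow> (\<exists>M. merging M) \<and> (\<exists>M. separating M)"
proof
  assume "(\<exists>M. merging M) \<and> (\<exists>M. separating M)"
  then obtain M N where "merging M" "separating N"
    by blast
  then have MN: "merging (max M N)" "separating (max M N)"
    by (auto intro: merging_mono separating_mono)
  have "T ` {1..n} \<subseteq> range \<phi>"
    using gen by (metis image_subsetI rangeI)
  moreover have "1 \<in> range \<phi>"
    using endo by (metis unital_star_endomorphism_def rangeI)
  ultimately show "surj \<phi>"
    using subalgebra_eq_UNIV[OF cuntz cstar_subalgebra_range[OF endo iso] _ _ MN] by simp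
next
  assume surj: "surj \<phi>"
  define h where "h p = (\<lambda>x. of_bool (x = Some p) :: complex)" for p :: "nat list \<times> nat list"
  define P where "P p M \<longleftrightarrow> (\<forall>u\<in>words n M. \<forall>v\<in>words n M.
      \<exists>z. norm (star (S_word T u) * local (h p) * S_word T v - scaleC z 1) < 1/2)" for p M
  have ev: "\<forall>\<^sub>F M in sequentially. P p M" for p
  proof -
    obtain x where x: "local (h p) = \<phi> x"
      using surj by (metis surjD)
    obtain K x' y' where K: "cuntz_pair.level_pair n S T K x' y'" "norm (local (h p) - y') < 1/2"
      using approx[of "1/2" x] unfolding x by auto
    have "P p M" if "K \<le> M" for M
      unfolding P_def
    proof (intro ballI)
      fix u v
      assume uv: "u \<in> words n M" "v \<in> words n M"
      show "\<exists>z. norm (star (S_word T u) * local (h p) * S_word T v - scaleC z 1) < 1/2"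
        by (rule compression_near_scalar_mono[OF _ that uv])
          (metis compression_near_scalar[OF K])
    qed
    then show ?thesis
      unfolding eventually_sequentially by blast
  qed
  have "\<forall>\<^sub>F M in sequentially. \<forall>p\<in>words n l \<times> words n l. P p M"
    by (rule eventually_ball_finite) (use ev in auto)
  then obtain M where M: "\<forall>p\<in>words n l \<times> words n l. P p M"
    unfolding eventually_sequentially by blast
  have "merging M" "separating M"
    by (rule merging_separating_of_near_scalar; use M in \<open>simp add: P_def h_def\<close>)+
  then show "(\<exists>M. merging M) \<and> (\<exists>M. separating M)"
    by blast
qed

end

section \<open>Orders and termination\<close>

text \<open>A strict descent in a finite order cannot go on for more steps than there are elements.\<close>

lemma foldr_in_sink_of_descent:
  assumes fin: "finite X" and ord: "partial_order_on X r"
    and X: "\<And>i x. i \<in> I \<Longrightarrow> x \<in> X \<Longrightarrow> g i x \<in> X"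
    and Z: "\<And>i x. i \<in> I \<Longrightarrow> x \<in> Z \<Longrightarrow> g i x \<in> Z"
    and desc: "\<And>i x. i \<in> I \<Longrightarrow> x \<in> X - Z \<Longrightarrow> (g i x, x) \<in> r - Id"
    and u: "set u \<subseteq> I" "card X \<le> length u" and x: "x \<in> X"
  shows "foldr g u x \<in> Z"
proof -
  have r: "refl_on X r" "trans r" "antisym r"
    using ord by (auto simp: partial_order_on_def preorder_on_def)
  define ht where "ht y = card {z \<in> X. (z, y) \<in> r}" for y
  have less: "ht (g i y) < ht y" if "i \<in> I" "y \<in> X - Z" for i y
    unfolding ht_def
  proof (rule psubset_card_mono)
    have d: "(g i y, y) \<in> r" "g i y \<noteq> y"
      using desc[OF that] by auto
    have "(y, g i y) \<notin> r"
      using d antisymD[OF r(3)] by blast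
    moreover have "(y, y) \<in> r"
      using that r(1) by (auto simp: refl_on_def)
    ultimately show "{z \<in> X. (z, g i y) \<in> r} \<subset> {z \<in> X. (z, y) \<in> r}"
      using d(1) that transD[OF r(2)] by blast
  qed (use fin in simp)
  have "foldr g u x \<in> X \<and> (foldr g u x \<in> Z \<or> ht (foldr g u x) + length u \<le> ht x)"
    using u(1)
  proof (induction u)
    case Nil
    then show ?case
      using x by simp
  next
    case (Cons i u)
    let ?y = "foldr g u x"
    have y: "?y \<in> X" "?y \<in> Z \<or> ht ?y + length u \<le> ht x" and i: "i \<in> I"
      using Cons by auto
    have "g i ?y \<in> Z \<or> ht (g i ?y) + length (i # u) \<le> ht x"
    proof (cases "?y \<in> Z")
      case True
      then show ?thesis
        using Z[OF i] by blast
    next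
      case False
      then show ?thesis
        using less[OF i, of ?y] y by simp
    qed
    then show ?case
      using X[OF i y(1)] by simp
  qed
  moreover have "ht x \<le> card X"
    unfolding ht_def by (intro card_mono fin) auto
  moreover have "ht y > 0" if "y \<in> X" for y
    using that r(1) fin by (auto simp: ht_def card_gt_0_iff refl_on_def)
  ultimately show ?thesis
    using u(2) by fastforce
qed

text \<open>Conversely, order \<open>X\<close> by reachability. A cycle would contain arbitrarily long paths which
  avoid \<open>Z\<close>.\<close>

lemma descent_order_of_foldr_in_sink:
  assumes X: "\<And>i x. i \<in> I \<Longrightarrow> x \<in> X \<Longrightarrow> g i x \<in> X" and "Z \<subseteq> X"
    and Z: "\<And>i x. i \<in> I \<Longrightarrow> x \<in> Z \<Longrightarrow> g i x \<in> Z"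
    and sink: "\<And>u x. length u = M \<Longrightarrow> set u \<subseteq> I \<Longrightarrow> x \<in> X \<Longrightarrow> foldr g u x \<in> Z"
    and "I \<noteq> {}"
  shows "\<exists>r. partial_order_on X r \<and> (\<forall>z\<in>Z. minimal_in X r z) \<and> (\<forall>x\<in>X. \<exists>z\<in>Z. (z, x) \<in> r) \<and>
    (\<forall>i\<in>I. \<forall>x\<in>X - Z. (g i x, x) \<in> r - Id)"
proof -
  define s where "s = {(g i x, x) | i x. i \<in> I \<and> x \<in> X - Z}"
  define r where "r = Id_on X \<union> s\<^sup>+"
  have "s \<subseteq> X \<times> X"
    using X by (auto simp: s_def)
  then have sub: "s\<^sup>+ \<subseteq> X \<times> X"
    by (rule trancl_subset_Sigma)
  have source: "x \<in> X - Z" if "(y, x) \<in> s\<^sup>+" for x y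
    using that by cases (auto simp: s_def)
  have path: "\<exists>u. length u = m \<and> set u \<subseteq> I \<and> y = foldr g u x" if "(y, x) \<in> s ^^ m" for m x y
    using that
  proof (induction m arbitrary: x)
    case (Suc m)
    then obtain i where i: "i \<in> I" "(y, g i x) \<in> s ^^ m"
      by (auto simp: s_def)
    then obtain u where "length u = m" "set u \<subseteq> I" "y = foldr g u (g i x)"
      using Suc.IH by blast
    then show ?case
      using i(1) by (intro exI[of _ "u @ [i]"]) simp
  qed simp
  have stay: "foldr g u x \<in> Z" if "set u \<subseteq> I" "x \<in> Z" for u x
    using that by (induction u) (auto intro: Z)
  have long: "foldr g u x \<in> Z" if "M \<le> length u" "set u \<subseteq> I" "x \<in> X" for u x
  proof -
    let ?a = "take (length u - M) u" and ?b = "drop (length u - M) u"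
    have "set ?a \<subseteq> I" "set ?b \<subseteq> I" "length ?b = M"
      using that set_take_subset[of "length u - M" u] set_drop_subset[of "length u - M" u] by auto
    then have "foldr g ?a (foldr g ?b x) \<in> Z"
      using that(3) by (intro stay sink)
    then show ?thesis
      using foldr_append[of g ?a ?b] by simp
  qed
  have acyclic: "(x, x) \<notin> s\<^sup>+" for x
  proof
    assume x: "(x, x) \<in> s\<^sup>+"
    then obtain m where m: "m > 0" "(x, x) \<in> s ^^ m"
      by (auto simp: trancl_power)
    have "(x, x) \<in> s ^^ (q * m)" for q
      by (induction q) (use m(2) in \<open>auto simp: relpow_add\<close>)
    then obtain u where u: "length u = M * m" "set u \<subseteq> I" "x = foldr g u x"
      using path by metis
    have "M \<le> length u"
      using u(1) m(1) by simp
    then have "foldr g u x \<in> Z"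
      using long u(2) source[OF x] by blast
    then show False
      using u(3) source[OF x] by simp
  qed
  have trans: "trans r"
    unfolding r_def trans_def by (auto intro: trancl_trans)
  have step: "(g i x, x) \<in> r" if "i \<in> I" "x \<in> X - Z" for i x
    using that by (auto simp: r_def s_def)
  show ?thesis
  proof (intro exI[of _ r] conjI ballI)
    show "partial_order_on X r"
      unfolding partial_order_on_def preorder_on_def
    proof (intro conjI trans)
      show "antisym r"
      proof (rule antisymI)
        fix x y
        assume "(x, y) \<in> r" "(y, x) \<in> r"
        then show "x = y"
          using acyclic trancl_trans[of x y s x] by (auto simp: r_def)
      qed
    qed (use sub in \<open>auto simp: r_def refl_on_def\<close>)
    show "minimal_in X r z" if "z \<in> Z" for z
      using that \<open>Z \<subseteq> X\<close> source by (auto simp: minimal_in_def r_def)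
    show "(g i x, x) \<in> r - Id" if "i \<in> I" "x \<in> X - Z" for i x
    proof -
      have "(g i x, x) \<in> s\<^sup>+"
        using that by (auto simp: s_def)
      then show ?thesis
        using acyclic[of x] by (auto simp: r_def)
    qed
    obtain i where i: "i \<in> I"
      using \<open>I \<noteq> {}\<close> by blast
    have below: "\<exists>z\<in>Z. (z, x) \<in> r" if "x \<in> X" "foldr g (replicate m i) x \<in> Z" for m x
      using that
    proof (induction m arbitrary: x)
      case 0
      then show ?case
        by (auto simp: r_def)
    next
      case (Suc m)
      show ?case
      proof (cases "x \<in> Z")
        case True
        then show ?thesis
          using Suc.prems by (auto simp: r_def)
      next
        case False
        have "replicate (Suc m) i = replicate m i @ [i]"
          by (simp add: replicate_append_same)
        then have "foldr g (replicate m i) (g i x) \<in> Z"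
          using Suc.prems(2) by (simp del: replicate_Suc)
        then obtain z where "z \<in> Z" "(z, g i x) \<in> r"
          using Suc.IH X[OF i Suc.prems(1)] by blast
        moreover have "(g i x, x) \<in> r"
          using step i Suc.prems(1) False by blast
        ultimately show ?thesis
          using transD[OF trans] by blast
      qed
    qed
    show "\<exists>z\<in>Z. (z, x) \<in> r" if "x \<in> X" for x
    proof (rule below[OF that])
      show "foldr g (replicate M i) x \<in> Z"
        by (rule sink) (use i that in auto)
    qed
  qed
qed

context word_permutation
begin

lemma finite_pairs_dagger: "finite (pairs_dagger n l)"
proof -
  have "pairs_dagger n l \<subseteq> insert None (Some ` (words n l \<times> words n l))"
    by (auto simp: pairs_dagger_def)
  then show ?thesis
    by (rule finite_subset) simp
qed

lemma ex_merging_iff: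
  assumes "1 \<le> n"
  shows "(\<exists>M. merging M) \<longleftrightarrow>
    (\<exists>r. partial_order_on (words n l \<times> words n l) r \<and>
       (\<forall>\<alpha>\<in>words n l. minimal_in (words n l \<times> words n l) r (\<alpha>, \<alpha>)) \<and>
       (\<forall>\<alpha>\<in>words n l. \<forall>\<beta>\<in>words n l. \<exists>\<gamma>\<in>words n l. ((\<gamma>, \<gamma>), (\<alpha>, \<beta>)) \<in> r) \<and>
       (\<forall>i\<in>{1..n}. \<forall>\<alpha>\<in>words n l. \<forall>\<beta>\<in>words n l. \<alpha> \<noteq> \<beta> \<longrightarrow>
          ((f i \<alpha>, f i \<beta>), (\<alpha>, \<beta>)) \<in> r - Id))" (is "?L \<longleftrightarrow> (\<exists>r. ?P r)")
proof -
  define g where "g i = (\<lambda>(\<alpha>, \<beta>). (f i \<alpha>, f i \<beta>))" for i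
  define X where "X = words n l \<times> words n l"
  define Z where "Z = (\<lambda>\<alpha>. (\<alpha>, \<alpha>)) ` words n l"
  have fold: "foldr g u (\<alpha>, \<beta>) = (foldr f u \<alpha>, foldr f u \<beta>)" for u \<alpha> \<beta>
    by (induction u) (auto simp: g_def)
  have gX: "g i x \<in> X" if "i \<in> {1..n}" "x \<in> X" for i x
    using that f_in_words by (auto simp: g_def X_def simp del: atLeastAtMost_iff)
  have gZ: "g i x \<in> Z" if "i \<in> {1..n}" "x \<in> Z" for i x
    using that f_in_words by (auto simp: g_def Z_def simp del: atLeastAtMost_iff)
  show ?thesis
  proof
    assume ?L
    then obtain M where M: "merging M"
      by blast
    have sink: "foldr g u x \<in> Z" if u: "length u = M" "set u \<subseteq> {1..n}" and x: "x \<in> X" for u x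
    proof -
      obtain \<alpha> \<beta> where ab: "x = (\<alpha>, \<beta>)" "\<alpha> \<in> words n l" "\<beta> \<in> words n l"
        using x by (auto simp: X_def)
      have "u \<in> words n M"
        using u by (simp add: words_def)
      then have "foldr f u \<alpha> = foldr f u \<beta>"
        using M ab unfolding merging_def by blast
      then have "foldr g u x = (foldr f u \<beta>, foldr f u \<beta>)"
        by (simp only: ab(1) fold)
      then show ?thesis
        using foldr_f_in_words[OF u(2) ab(3)] by (simp add: Z_def)
    qed
    have "\<exists>r. partial_order_on X r \<and> (\<forall>z\<in>Z. minimal_in X r z) \<and>
        (\<forall>x\<in>X. \<exists>z\<in>Z. (z, x) \<in> r) \<and> (\<forall>i\<in>{1..n}. \<forall>x\<in>X - Z. (g i x, x) \<in> r - Id)"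
    proof (rule descent_order_of_foldr_in_sink[OF gX _ gZ sink])
      show "Z \<subseteq> X"
        by (auto simp: Z_def X_def)
      show "{1..n} \<noteq> {}"
        using assms by simp
    qed
    then obtain r where r: "partial_order_on X r" "\<forall>z\<in>Z. minimal_in X r z"
      "\<forall>x\<in>X. \<exists>z\<in>Z. (z, x) \<in> r" "\<forall>i\<in>{1..n}. \<forall>x\<in>X - Z. (g i x, x) \<in> r - Id"
      by blast
    have "?P r"
    proof (intro conjI ballI impI)
      show "partial_order_on (words n l \<times> words n l) r"
        using r(1) by (simp add: X_def)
      show "minimal_in (words n l \<times> words n l) r (\<alpha>, \<alpha>)" if "\<alpha> \<in> words n l" for \<alpha>
        using r(2) that unfolding X_def Z_def by blast
      show "\<exists>\<gamma>\<in>words n l. ((\<gamma>, \<gamma>), (\<alpha>, \<beta>)) \<in> r" if "\<alpha> \<in> words n l" "\<beta> \<in> words n l" for \<alpha> \<beta>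
        using r(3) that unfolding X_def Z_def by blast
      show "((f i \<alpha>, f i \<beta>), (\<alpha>, \<beta>)) \<in> r - Id"
        if "i \<in> {1..n}" "\<alpha> \<in> words n l" "\<beta> \<in> words n l" "\<alpha> \<noteq> \<beta>" for i \<alpha> \<beta>
      proof -
        have "(\<alpha>, \<beta>) \<in> X - Z"
          using that by (auto simp: X_def Z_def)
        then have "(g i (\<alpha>, \<beta>), (\<alpha>, \<beta>)) \<in> r - Id"
          using r(4) that(1) by blast
        then show ?thesis
          by (simp add: g_def)
      qed
    qed
    then show "\<exists>r. ?P r"
      by (rule exI)
  next
    assume "\<exists>r. ?P r"
    then obtain r where P: "?P r"
      by (rule exE)
    have r: "partial_order_on X r"
      unfolding X_def by (rule conjunct1[OF P])
    have desc: "\<forall>i\<in>{1..n}. \<forall>\<alpha>\<in>words n l. \<forall>\<beta>\<in>words n l. \<alpha> \<noteq> \<beta> \<longrightarrow>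
          ((f i \<alpha>, f i \<beta>), (\<alpha>, \<beta>)) \<in> r - Id"
      by (rule conjunct2[OF conjunct2[OF conjunct2[OF P]]])
    have "merging (card X)"
      unfolding merging_def
    proof (intro ballI)
      fix u \<alpha> \<beta>
      assume u: "u \<in> words n (card X)" and w: "\<alpha> \<in> words n l" "\<beta> \<in> words n l"
      have "foldr g u (\<alpha>, \<beta>) \<in> Z"
      proof (rule foldr_in_sink_of_descent[OF _ r gX gZ])
        show "(g i x, x) \<in> r - Id" if ix: "i \<in> {1..n}" "x \<in> X - Z" for i x
        proof -
          obtain \<alpha>' \<beta>' where x: "x = (\<alpha>', \<beta>')" "\<alpha>' \<in> words n l" "\<beta>' \<in> words n l" "\<alpha>' \<noteq> \<beta>'"
            using ix(2) by (auto simp: X_def Z_def)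
          have "((f i \<alpha>', f i \<beta>'), (\<alpha>', \<beta>')) \<in> r - Id"
            by (rule desc[rule_format, OF ix(1) x(2-4)])
          then show ?thesis
            by (simp add: x(1) g_def)
        qed
        show "finite X" "(\<alpha>, \<beta>) \<in> X"
          using w by (simp_all add: X_def)
        show "set u \<subseteq> {1..n}" "card X \<le> length u"
          using u by (simp_all add: words_def)
      qed
      then show "foldr f u \<alpha> = foldr f u \<beta>"
        unfolding fold by (auto simp: Z_def)
    qed
    then show ?L
      by blast
  qed
qed

lemma ex_separating_iff:
  assumes "1 \<le> n"
  shows "(\<exists>M. separating M) \<longleftrightarrow>
    (\<exists>r. partial_order_on (pairs_dagger n l) r \<and>
       (\<forall>x. minimal_in (pairs_dagger n l) r x \<longleftrightarrow> x = None) \<and>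
       (\<forall>x\<in>pairs_dagger n l - {None}. \<forall>i\<in>{1..n}. \<forall>j\<in>{1..n}.
          (f2_map n (Suc l) \<sigma> i j x, x) \<in> r - Id))" (is "?L \<longleftrightarrow> (\<exists>r. ?P r)")
proof
  assume ?L
  then obtain M where M: "separating M"
    by blast
  have sink: "foldr F u x \<in> {None}"
    if "length u = M" "set u \<subseteq> {1..n} \<times> {1..n}" "x \<in> pairs_dagger n l" for u x
    using M that unfolding separating_def by blast
  have None: "F p x \<in> {None}" if "x \<in> {None}" for p x
    using that F_None by (simp only: singleton_iff)
  have "\<exists>r. partial_order_on (pairs_dagger n l) r \<and>
      (\<forall>z\<in>{None}. minimal_in (pairs_dagger n l) r z) \<and>
      (\<forall>x\<in>pairs_dagger n l. \<exists>z\<in>{None}. (z, x) \<in> r) \<and>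
      (\<forall>p\<in>{1..n} \<times> {1..n}. \<forall>x\<in>pairs_dagger n l - {None}. (F p x, x) \<in> r - Id)"
  proof (rule descent_order_of_foldr_in_sink[OF F_in_pairs_dagger _ None sink])
    show "{None} \<subseteq> pairs_dagger n l"
      by (simp add: pairs_dagger_def)
    show "{1..n} \<times> {1..n} \<noteq> {}"
      using assms by simp
  qed
  then obtain r where r: "partial_order_on (pairs_dagger n l) r"
    "\<forall>z\<in>{None}. minimal_in (pairs_dagger n l) r z"
    "\<forall>x\<in>pairs_dagger n l. \<exists>z\<in>{None}. (z, x) \<in> r"
    "\<forall>p\<in>{1..n} \<times> {1..n}. \<forall>x\<in>pairs_dagger n l - {None}. (F p x, x) \<in> r - Id"
    by blast
  have "?P r"
  proof (intro conjI ballI allI)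
    show "minimal_in (pairs_dagger n l) r x \<longleftrightarrow> x = None" for x
    proof
      assume x: "minimal_in (pairs_dagger n l) r x"
      then have "(None, x) \<in> r"
        using r(3) by (auto simp: minimal_in_def)
      then show "x = None"
        using x by (auto simp: minimal_in_def pairs_dagger_def)
    next
      assume "x = None"
      then show "minimal_in (pairs_dagger n l) r x"
        using r(2) by blast
    qed
    show "(f2_map n (Suc l) \<sigma> i j x, x) \<in> r - Id"
      if "x \<in> pairs_dagger n l - {None}" "i \<in> {1..n}" "j \<in> {1..n}" for x i j
      using bspec[OF bspec[OF r(4), of "(i, j)"] that(1)] that(2,3) by simp
  qed (rule r(1))
  then show "\<exists>r. ?P r"
    by (rule exI)
next
  assume "\<exists>r. ?P r"
  then obtain r where P: "?P r"
    by (rule exE)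
  have r: "partial_order_on (pairs_dagger n l) r"
    by (rule conjunct1[OF P])
  have desc: "\<forall>x\<in>pairs_dagger n l - {None}. \<forall>i\<in>{1..n}. \<forall>j\<in>{1..n}.
      (f2_map n (Suc l) \<sigma> i j x, x) \<in> r - Id"
    by (rule conjunct2[OF conjunct2[OF P]])
  have "separating (card (pairs_dagger n l))"
    unfolding separating_def
  proof (intro allI impI ballI)
    fix u x
    assume u: "length u = card (pairs_dagger n l)" "set u \<subseteq> {1..n} \<times> {1..n}"
      and x: "x \<in> pairs_dagger n l"
    have "foldr F u x \<in> {None}"
    proof (rule foldr_in_sink_of_descent[OF finite_pairs_dagger r F_in_pairs_dagger])
      show "F p x \<in> {None}" if "x \<in> {None}" for p x
        using that F_None by (simp only: singleton_iff)
      show "(F p x, x) \<in> r - Id"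
        if "p \<in> {1..n} \<times> {1..n}" "x \<in> pairs_dagger n l - {None}" for p x
        using desc[rule_format, OF that(2), of "fst p" "snd p"] that(1)
        by (simp add: case_prod_unfold mem_Times_iff)
    qed (use u x in auto)
    then show "foldr F u x = None"
      by blast
  qed
  then show ?L
    by blast
qed

end

section \<open>The criterion\<close>

theorem corollary4p12:
  fixes n k :: nat
    and S :: "nat \<Rightarrow> 'a::cstar_algebra"
    and \<sigma> :: "nat list \<Rightarrow> nat list"
    and w :: 'a
  assumes "n \<ge> 2" and "k \<ge> 1"
    and "cuntz_algebra n S"
    and "\<sigma> permutes words n k"
    and "w = perm_unitary n k S \<sigma>"
  shows "cuntz_endomorphism n S w \<in> star_automorphisms \<longleftrightarrow>
    (\<exists>r. partial_order_on (words n (k - 1) \<times> words n (k - 1)) r \<and>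
       (\<forall>\<alpha>\<in>words n (k - 1). minimal_in (words n (k - 1) \<times> words n (k - 1)) r (\<alpha>, \<alpha>)) \<and>
       (\<forall>\<alpha>\<in>words n (k - 1). \<forall>\<beta>\<in>words n (k - 1).
          \<exists>\<gamma>\<in>words n (k - 1). ((\<gamma>, \<gamma>), (\<alpha>, \<beta>)) \<in> r) \<and>
       (\<forall>i\<in>{1..n}. \<forall>\<alpha>\<in>words n (k - 1). \<forall>\<beta>\<in>words n (k - 1). \<alpha> \<noteq> \<beta> \<longrightarrow>
          ((f_map n k \<sigma> i \<alpha>, f_map n k \<sigma> i \<beta>), (\<alpha>, \<beta>)) \<in> r - Id)) \<and>
    (\<exists>r. partial_order_on (pairs_dagger n (k - 1)) r \<and>
       (\<forall>x. minimal_in (pairs_dagger n (k - 1)) r x \<longleftrightarrow> x = None) \<and>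
       (\<forall>x\<in>pairs_dagger n (k - 1) - {None}. \<forall>i\<in>{1..n}. \<forall>j\<in>{1..n}.
          (f2_map n k \<sigma> i j x, x) \<in> r - Id))"
proof -
  define l where "l = k - 1"
  have k: "k = Suc l"
    using assms(2) by (simp add: l_def)
  interpret cuntz_family n S
    by (rule cuntz_algebra_imp_family[OF assms(1,3)])
  interpret permutation_endomorphism n S l \<sigma>
    by unfold_locales (use assms(4) in \<open>simp add: k\<close>)
  have w: "w = perm_unitary n (Suc l) S \<sigma>"
    by (simp add: assms(5) k)
  obtain \<phi> where \<phi>: "unital_star_endomorphism \<phi>" "\<And>x. norm (\<phi> x) = norm x"
    "\<And>i. i \<in> {1..n} \<Longrightarrow> \<phi> (S i) = T i"
    "\<And>x \<epsilon>. \<epsilon> > 0 \<Longrightarrow> \<exists>K x' y'. cuntz_pair.level_pair n S T K x' y' \<and> norm (\<phi> x - y') < \<epsilon>"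
    using cuntz_algebra_universal[OF assms(1,3) cuntz_family_T] by blast
  have "cuntz_endomorphism n S w = \<phi>"
    unfolding cuntz_endomorphism_def
  proof (rule the_equality)
    show "unital_star_endomorphism \<phi> \<and> (\<forall>i\<in>{1..n}. \<phi> (S i) = star w * S i)"
      using \<phi>(1,3) by (simp add: T_def w)
    show "\<psi> = \<phi>" if "unital_star_endomorphism \<psi> \<and> (\<forall>i\<in>{1..n}. \<psi> (S i) = star w * S i)" for \<psi>
      by (rule unital_star_endomorphism_unique[OF assms(3) _ \<phi>(1)])
        (use that \<phi>(3) in \<open>simp_all add: T_def w\<close>)
  qed
  moreover have "inj \<phi>"
  proof (rule injI)
    fix x y
    assume "\<phi> x = \<phi> y"
    moreover have "\<phi> (x - y) = \<phi> x - \<phi> y"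
      using \<phi>(1) unfolding unital_star_endomorphism_def by (metis diff_add_cancel add_diff_cancel)
    ultimately show "x = y"
      using \<phi>(2)[of "x - y"] by simp
  qed
  ultimately have "cuntz_endomorphism n S w \<in> star_automorphisms \<longleftrightarrow> surj \<phi>"
    using \<phi>(1) by (auto simp: star_automorphisms_def bij_def)
  also have "\<dots> \<longleftrightarrow> (\<exists>M. merging M) \<and> (\<exists>M. separating M)"
    by (rule surj_iff_merging_separating[OF assms(3) \<phi>])
  finally show ?thesis
    using ex_merging_iff ex_separating_iff two_le_n unfolding k by simp
qed

end
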